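(* An oriented graph $D$ is a global K-graph if and only if it is a local K-graph.
   Context: **Digraphs.** A digraph is an irreflexive binary relation $D$ on a finite nonempty set, the set of vertices of $D$. The ordered pairs in $D$ are its edges; an edge $(a,b)$ begins in $a$ and ends in $b$. An oriented graph is an antisymmetric digraph (if $(a,b)\in D$ then $(b,a)\notin D$). A W-vertex of $D$ is a vertex in which no edge ends; an E-vertex is a vertex in which no edge begins; an inner vertex is one that is neither. A W-edge is an edge beginning in a W-vertex; an E-edge is an edge ending in an E-vertex. A W-edge $(a,b)$ is functional when $(a,c)\in D$ implies $c=b$; an E-edge $(b,a)$ is functional when $(c,a)\in D$ implies $c=b$. Digraphs are disjoint when their vertex sets are disjoint. **Semipaths.** For $n\ge 1$ consider a sequence $a_1,\dots,a_n$ of vertices such that for every $i\in\{1,\dots,n-1\}$ we have $(a_i,a_{i+1})\in D$ or $(a_{i+1},a_i)\in D$. It is a semipath when all its vertices are mutually distinct (joining $a_1$ to $a_n$); it is a semicycle when $a_1=a_n$, $n\ge 4$, and $a_1,\dots,a_{n-1}$ are mutually distinct. A path is a semipath with $(a_i,a_{i+1})\in D$ for every $i\in\{1,\dots,n-1\}$. $D$ is weakly connected when every two vertices are joined by a semipath; asemicyclic when it has no semicycles; W-E-functional when all its W-edges and E-edges are functional. **Basic K-graphs.** A basic K-graph $B$ is an oriented graph with vertices $a_1,\dots,a_{k_W},b,c_1,\dots,c_{k_E}$ (all distinct, $k_W,k_E\ge 1$) and edges exactly $(a_i,b)$ for $1\le i\le k_W$ and $(b,c_j)$ for $1\le j\le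 k_E$, together with distinguished W-edges $NW(B),SW(B)$ and distinguished E-edges $NE(B),SE(B)$, such that for each $X\in\{W,E\}$: if $k_X\ge 2$, then $NX(B)\ne SX(B)$. **Cut.** Let $D_W,D_E$ be disjoint oriented graphs, $e_W=(a,b)$ a functional E-edge of $D_W$ and $e_E=(c,d)$ a functional W-edge of $D_E$. With $e=(a,d)$, $D_W[e_W-e_E]D_E$ is the oriented graph $(D_W-\{e_W\})\cup(D_E-\{e_E\})\cup\{e\}$ on the union of the vertices of $D_W$ and $D_E$ with $b$ and $c$ omitted. **Constructions.** A construction $G$ is a finite binary tree with an oriented graph and distinguished edges at each node; the graph at the root is the root graph of $G$, and its distinguished edges at the root are denoted $YX(G)$, $Y\in\{N,S\}$, $X\in\{W,E\}$. Constructions are defined inductively: (1) a single-node tree whose node carries a basic K-graph $B$ with its distinguished edges is a construction; (2) if $G_W,G_E$ are constructions with disjoint root graphs $D_W,D_E$, $e_W$ is a functional E-edge of $D_W$ and $e_E$ is a functional W-edge of $D_E$, and for every $Y\in\{N,S\}$ we have $e_W=YE(G_W)$ or $e_E=YW(G_E)$, then $G=G_W[e_W-e_E]G_E$ is a construction: its tree has a new root whose successors are the roots of $G_W$ and $G_E$, its root graph is $D_W[e_W-e_E]D_E$, and for $Y\in\{N,S\}$, $YW(G)=YW(G_W)$ if $e_E=YW(G_E)$ and $YW(G)=YW(G_E)$ otherwise; $YE(G)=YE(G_E)$ if $e_W=YE(G_W)$ and $YE(G)=YE(G_W)$ otherwise. The other nodes keep their data from $G_W$ and $G_E$. A global K-graph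 is an oriented graph that is the root graph of a construction. **Local K-graphs.** For a digraph $D$ let $\mathcal{L}$ be a set of four functions $NW,SW,NE,SE$ on the inner vertices of $D$ such that, for $Y\in\{N,S\}$ and every inner vertex $a$, $YW(a)$ is an edge of $D$ of the form $(b,a)$ and $YE(a)$ is an edge of $D$ of the form $(a,b)$. For an inner vertex $a$ let $k^a_W$ be the number of edges ending in $a$ and $k^a_E$ the number of edges beginning in $a$. $\langle D,\mathcal{L}\rangle$ separates $N$ from $S$ when for every inner vertex $a$ and every $X\in\{W,E\}$: if $k^a_X\ge 2$ then $NX(a)\ne SX(a)$. A path $a_1,\dots,a_n$ of $D$ is $Y$-decent in $\langle D,\mathcal{L}\rangle$ when $n=1$, or $n\ge 2$ and [$YE(a_1)=(a_1,a_2)$ or $YW(a_n)=(a_{n-1},a_n)$] (an equality involving a function at a vertex that is not inner counts as false); it is decent when it is both $N$-decent and $S$-decent. For an oriented graph $D$, $\langle D,\mathcal{L}\rangle$ is a local compass graph when $D$ is weakly connected, asemicyclic, W-E-functional and has an inner vertex, $\langle D,\mathcal{L}\rangle$ separates $N$ from $S$, and every path of $D$ all of whose vertices are inner is decent in $\langle D,\mathcal{L}\rangle$. An oriented graph $D$ is a local K-graph when $\langle D,\mathcal{L}\rangle$ is a local compass graph for some $\mathcal{L}$. *)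

theory Defs
  imports "Graph_Theory.Pair_Digraph" "HOL-Library.Tree"
begin

section \<open>Digraphs\<close>

definition finite_digraph :: "'a pair_pre_digraph \<Rightarrow> bool" where
  "finite_digraph D \<longleftrightarrow> pair_digraph D \<and> pverts D \<noteq> {}"

definition oriented_graph :: "'a pair_pre_digraph \<Rightarrow> bool" where
  "oriented_graph D \<longleftrightarrow> finite_digraph D \<and>
     (\<forall>a b. (a, b) \<in> parcs D \<longrightarrow> (b, a) \<notin> parcs D)"

definition W_vertex :: "'a pair_pre_digraph \<Rightarrow> 'a \<Rightarrow> bool" where
  "W_vertex D a \<longleftrightarrow> a \<in> pverts D \<and> (\<forall>b. (b, a) \<notin> parcs D)"

definition E_vertex :: "'a pair_pre_digraph \<Rightarrow> 'a \<Rightarrow> bool" where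
  "E_vertex D a \<longleftrightarrow> a \<in> pverts D \<and> (\<forall>b. (a, b) \<notin> parcs D)"

definition inner_vertex :: "'a pair_pre_digraph \<Rightarrow> 'a \<Rightarrow> bool" where
  "inner_vertex D a \<longleftrightarrow> a \<in> pverts D \<and> \<not> W_vertex D a \<and> \<not> E_vertex D a"

definition W_edge :: "'a pair_pre_digraph \<Rightarrow> 'a \<times> 'a \<Rightarrow> bool" where
  "W_edge D e \<longleftrightarrow> e \<in> parcs D \<and> W_vertex D (fst e)"

definition E_edge :: "'a pair_pre_digraph \<Rightarrow> 'a \<times> 'a \<Rightarrow> bool" where
  "E_edge D e \<longleftrightarrow> e \<in> parcs D \<and> E_vertex D (snd e)"

definition functional_W_edge :: "'a pair_pre_digraph \<Rightarrow> 'a \<times> 'a \<Rightarrow> bool" where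
  "functional_W_edge D e \<longleftrightarrow> W_edge D e \<and> (\<forall>c. (fst e, c) \<in> parcs D \<longrightarrow> c = snd e)"

definition functional_E_edge :: "'a pair_pre_digraph \<Rightarrow> 'a \<times> 'a \<Rightarrow> bool" where
  "functional_E_edge D e \<longleftrightarrow> E_edge D e \<and> (\<forall>c. (c, snd e) \<in> parcs D \<longrightarrow> c = fst e)"

definition W_E_functional :: "'a pair_pre_digraph \<Rightarrow> bool" where
  "W_E_functional D \<longleftrightarrow>
     (\<forall>e. W_edge D e \<longrightarrow> functional_W_edge D e) \<and>
     (\<forall>e. E_edge D e \<longrightarrow> functional_E_edge D e)"

section \<open>Semipaths\<close>

text \<open>A sequence a_1, ..., a_n is a nonempty list with a_i at list position i - 1.\<close>

definition semiwalk :: "'a pair_pre_digraph \<Rightarrow> 'a list \<Rightarrow> bool" where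
  "semiwalk D xs \<longleftrightarrow> xs \<noteq> [] \<and> set xs \<subseteq> pverts D \<and>
     (\<forall>i. Suc i < length xs \<longrightarrow>
        (xs ! i, xs ! Suc i) \<in> parcs D \<or> (xs ! Suc i, xs ! i) \<in> parcs D)"

definition semipath :: "'a pair_pre_digraph \<Rightarrow> 'a list \<Rightarrow> bool" where
  "semipath D xs \<longleftrightarrow> semiwalk D xs \<and> distinct xs"

definition semicycle :: "'a pair_pre_digraph \<Rightarrow> 'a list \<Rightarrow> bool" where
  "semicycle D xs \<longleftrightarrow> semiwalk D xs \<and> hd xs = last xs \<and> length xs \<ge> 4 \<and> distinct (butlast xs)"

definition directed_path :: "'a pair_pre_digraph \<Rightarrow> 'a list \<Rightarrow> bool" where
  "directed_path D xs \<longleftrightarrow> semipath D xs \<and>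
     (\<forall>i. Suc i < length xs \<longrightarrow> (xs ! i, xs ! Suc i) \<in> parcs D)"

definition weakly_connected :: "'a pair_pre_digraph \<Rightarrow> bool" where
  "weakly_connected D \<longleftrightarrow>
     (\<forall>a\<in>pverts D. \<forall>b\<in>pverts D. \<exists>xs. semipath D xs \<and> hd xs = a \<and> last xs = b)"

definition asemicyclic :: "'a pair_pre_digraph \<Rightarrow> bool" where
  "asemicyclic D \<longleftrightarrow> (\<nexists>xs. semicycle D xs)"

section \<open>Constructions and global K-graphs\<close>

datatype vertical = North | South
datatype horizontal = West | East

text \<open>The distinguished edge YX is \<open>d Y X\<close>, for example NW is \<open>d North West\<close>.\<close>

type_synonym 'a distinguished = "vertical \<Rightarrow> horizontal \<Rightarrow> 'a \<times> 'a"

definition basic_K_graph :: "'a pair_pre_digraph \<Rightarrow> 'a distinguished \<Rightarrow> bool" where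
  "basic_K_graph B d \<longleftrightarrow> oriented_graph B \<and>
     (\<exists>as b cs. as \<noteq> [] \<and> cs \<noteq> [] \<and> distinct (as @ b # cs) \<and>
        pverts B = set (as @ b # cs) \<and>
        parcs B = set as \<times> {b} \<union> {b} \<times> set cs \<and>
        (\<forall>Y. W_edge B (d Y West) \<and> E_edge B (d Y East)) \<and>
        (length as \<ge> 2 \<longrightarrow> d North West \<noteq> d South West) \<and>
        (length cs \<ge> 2 \<longrightarrow> d North East \<noteq> d South East))"

definition cut ::
  "'a pair_pre_digraph \<Rightarrow> 'a \<times> 'a \<Rightarrow> 'a \<times> 'a \<Rightarrow> 'a pair_pre_digraph \<Rightarrow> 'a pair_pre_digraph" where
  "cut DW eW eE DE =
     \<lparr> pverts = (pverts DW \<union> pverts DE) - {snd eW, fst eE},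
       parcs = (parcs DW - {eW}) \<union> (parcs DE - {eE}) \<union> {(fst eW, snd eE)} \<rparr>"

text \<open>Every tree node carries an oriented graph with its distinguished edges. In the library's binary
  trees \<open>Leaf\<close> is the empty tree, so a single-node tree is \<open>Node Leaf x Leaf\<close>.\<close>

type_synonym 'a construction_tree = "('a pair_pre_digraph \<times> 'a distinguished) tree"

definition root_graph :: "'a construction_tree \<Rightarrow> 'a pair_pre_digraph" where
  "root_graph G = fst (value G)"

definition root_edge :: "'a construction_tree \<Rightarrow> 'a distinguished" where
  "root_edge G = snd (value G)"

definition cut_edges ::
  "'a construction_tree \<Rightarrow> 'a \<times> 'a \<Rightarrow> 'a \<times> 'a \<Rightarrow> 'a construction_tree \<Rightarrow> 'a distinguished" where
  "cut_edges GW eW eE GE Y X =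
     (case X of
        West \<Rightarrow> (if eE = root_edge GE Y West then root_edge GW Y West else root_edge GE Y West)
      | East \<Rightarrow> (if eW = root_edge GW Y East then root_edge GE Y East else root_edge GW Y East))"

inductive construction :: "'a construction_tree \<Rightarrow> bool" where
  basic: "basic_K_graph B d \<Longrightarrow> construction (Node Leaf (B, d) Leaf)"
| cut: "\<lbrakk> construction GW; construction GE;
          pverts (root_graph GW) \<inter> pverts (root_graph GE) = {};
          functional_E_edge (root_graph GW) eW;
          functional_W_edge (root_graph GE) eE;
          \<And>Y. eW = root_edge GW Y East \<or> eE = root_edge GE Y West \<rbrakk>
        \<Longrightarrow> construction
              (Node GW (cut (root_graph GW) eW eE (root_graph GE), cut_edges GW eW eE GE) GE)"

text \<open>Each cut omits two vertices, so a construction of \<open>D\<close> uses vertices outside \<open>D\<close>. The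
  notion is meant for an infinite vertex type, where fresh vertices are always available.\<close>

definition global_K_graph :: "'a pair_pre_digraph \<Rightarrow> bool" where
  "global_K_graph D \<longleftrightarrow> oriented_graph D \<and> (\<exists>G. construction G \<and> root_graph G = D)"

section \<open>Local K-graphs\<close>

text \<open>The function YX on the inner vertices is \<open>L Y X\<close>; its values at other vertices are irrelevant.\<close>

type_synonym 'a compass = "vertical \<Rightarrow> horizontal \<Rightarrow> 'a \<Rightarrow> 'a \<times> 'a"

definition compass_on :: "'a pair_pre_digraph \<Rightarrow> 'a compass \<Rightarrow> bool" where
  "compass_on D L \<longleftrightarrow>
     (\<forall>Y a. inner_vertex D a \<longrightarrow>
        L Y West a \<in> parcs D \<and> snd (L Y West a) = a \<and>
        L Y East a \<in> parcs D \<and> fst (L Y East a) = a)"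

definition separates_N_from_S :: "'a pair_pre_digraph \<Rightarrow> 'a compass \<Rightarrow> bool" where
  "separates_N_from_S D L \<longleftrightarrow>
     (\<forall>a. inner_vertex D a \<longrightarrow>
        (in_degree (with_proj D) a \<ge> 2 \<longrightarrow> L North West a \<noteq> L South West a) \<and>
        (out_degree (with_proj D) a \<ge> 2 \<longrightarrow> L North East a \<noteq> L South East a))"

text \<open>Used only for directed paths \<open>xs\<close>.\<close>

definition Y_decent :: "'a pair_pre_digraph \<Rightarrow> 'a compass \<Rightarrow> vertical \<Rightarrow> 'a list \<Rightarrow> bool" where
  "Y_decent D L Y xs \<longleftrightarrow> length xs = 1 \<or>
     length xs \<ge> 2 \<and>
       (inner_vertex D (hd xs) \<and> L Y East (hd xs) = (xs ! 0, xs ! 1) \<or>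
        inner_vertex D (last xs) \<and>
          L Y West (last xs) = (xs ! (length xs - 2), xs ! (length xs - 1)))"

definition decent :: "'a pair_pre_digraph \<Rightarrow> 'a compass \<Rightarrow> 'a list \<Rightarrow> bool" where
  "decent D L xs \<longleftrightarrow> Y_decent D L North xs \<and> Y_decent D L South xs"

definition local_compass_graph :: "'a pair_pre_digraph \<Rightarrow> 'a compass \<Rightarrow> bool" where
  "local_compass_graph D L \<longleftrightarrow> oriented_graph D \<and> compass_on D L \<and>
     weakly_connected D \<and> asemicyclic D \<and> W_E_functional D \<and> (\<exists>a. inner_vertex D a) \<and>
     separates_N_from_S D L \<and>
     (\<forall>xs. directed_path D xs \<and> (\<forall>a\<in>set xs. inner_vertex D a) \<longrightarrow> decent D L xs)"

definition local_K_graph :: "'a pair_pre_digraph \<Rightarrow> bool" where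
  "local_K_graph D \<longleftrightarrow> oriented_graph D \<and> (\<exists>L. local_compass_graph D L)"

end

theory Submission
  imports Defs
begin

text \<open>The graphs in question are trees, and a distinguished edge YE of a construction can be
  recognised in the final graph: it is the only E-edge \<open>(x, y)\<close> such that the pointers YE of all inner
  vertices from which \<open>x\<close> can be reached lead to \<open>(x, y)\<close> (call such an edge good; good W-edges are
  dual). If an edge \<open>(a, d)\<close> between inner vertices is cut into \<open>(a, b)\<close> and \<open>(c, d)\<close>, decency of the
  paths through \<open>(a, d)\<close> says that \<open>(a, b)\<close> is good on the West side or \<open>(c, d)\<close> on the East side, which by
  uniqueness is the side condition on cuts. So a local K-graph can be cut at any inner edge, and
  induction on the number of inner edges applies; conversely, goodness of the distinguished edges is
  the invariant that makes paths through a cut decent. Uniqueness of good edges is preserved by cuts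
  because a directed path leads from YW to YE.\<close>

section \<open>Trees and compasses as relations\<close>

text \<open>Lists would have to be spliced at every cut. So a graph is replaced by its set of arcs,
  with \<open>Field\<close> as vertex set, connectedness by reachability in the symmetric closure,
  and the absence of semicycles by the condition that every arc is a bridge. A cut is then handled
  by maps that rename one vertex or contract one half to a point; lists occur only where the local
  definition is translated. Reversing all arcs exchanges West and East, so many facts are proved for
  one side and dualised. Gluing and splitting are two readings of one relation between
  \<open>A\<close> and its halves, and share a locale. The delicate point is uniqueness of good
  edges. When \<open>(a, b)\<close> is not YE of the West half, that half passes on its YE, so YE of
  the East half has to stop being good. Goodness alone does not show this: it constrains only the
  vertices that lead to the edge, so a way from \<open>d\<close> to YE of the East half is required
  to make the constraint reach back over \<open>(a, d)\<close> into the West half. The directed path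
  from YW to YE supplies it, since the side condition then makes \<open>(c, d)\<close> the YW of the
  East half. Uniqueness and this path are carried through the induction together.\<close>

definition sym_arcs :: "('a \<times> 'a) set \<Rightarrow> ('a \<times> 'a) set" where
  "sym_arcs A = A \<union> A\<inverse>"

lemma sym_arcs_converse [simp]: "sym_arcs (A\<inverse>) = sym_arcs A"
  by (auto simp: sym_arcs_def)

lemma rtrancl_sym_arcs_sym: "(x, y) \<in> (sym_arcs A)\<^sup>* \<Longrightarrow> (y, x) \<in> (sym_arcs A)\<^sup>*"
proof -
  have "sym (sym_arcs A)" by (auto simp: sym_arcs_def sym_def)
  then show "(x, y) \<in> (sym_arcs A)\<^sup>* \<Longrightarrow> (y, x) \<in> (sym_arcs A)\<^sup>*"
    using sym_rtrancl by (metis symD)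
qed

lemma arcs_rtrancl_sym_arcs: "A\<^sup>* \<subseteq> (sym_arcs A)\<^sup>*"
  by (rule rtrancl_mono) (auto simp: sym_arcs_def)

text \<open>Images of arcs need only be connected, not adjacent, because some of the maps used later
  contract a whole half of a cut to one vertex.\<close>

lemma rtrancl_sym_arcs_hom:
  assumes "(x, y) \<in> (sym_arcs A)\<^sup>*"
    and hom: "\<And>p q. (p, q) \<in> A \<Longrightarrow> (f p, f q) \<in> (sym_arcs B)\<^sup>*"
  shows "(f x, f y) \<in> (sym_arcs B)\<^sup>*"
  using assms(1)
proof induction
  case (step y z)
  then have "(f y, f z) \<in> (sym_arcs B)\<^sup>*"
    using hom rtrancl_sym_arcs_sym unfolding sym_arcs_def by fast
  with step.IH show ?case by (rule rtrancl_trans)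
qed simp

text \<open>Mostly a means of refuting reachability: \<open>X\<close> is a set that no arc enters or
  leaves.\<close>

lemma rtrancl_sym_arcs_closed:
  assumes "(x, y) \<in> (sym_arcs A)\<^sup>*" and "x \<in> X"
    and "\<And>p q. (p, q) \<in> A \<Longrightarrow> p \<in> X \<longleftrightarrow> q \<in> X"
  shows "y \<in> X"
  using assms(1,2) by induction (use assms(3) in \<open>auto simp: sym_arcs_def\<close>)

text \<open>The second conjunct makes every arc a bridge. This also excludes loops and pairs of
  opposite arcs, and it can be transported along maps without handling cycles.\<close>

definition tree_arcs :: "('a \<times> 'a) set \<Rightarrow> bool" where
  "tree_arcs A \<longleftrightarrow>
     (\<forall>u\<in>Field A. \<forall>v\<in>Field A. (u, v) \<in> (sym_arcs A)\<^sup>*) \<and>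
     (\<forall>u v. (u, v) \<in> A \<longrightarrow> (u, v) \<notin> (sym_arcs (A - {(u, v)}))\<^sup>*)"

lemma tree_arcs_converse: "tree_arcs A \<Longrightarrow> tree_arcs (A\<inverse>)"
proof -
  assume t: "tree_arcs A"
  have "sym_arcs (A\<inverse> - {(u, v)}) = sym_arcs (A - {(v, u)})" for u v
    by (auto simp: sym_arcs_def)
  with t show ?thesis
    unfolding tree_arcs_def by (auto dest: rtrancl_sym_arcs_sym)
qed

lemma tree_arcs_asym: "tree_arcs A \<Longrightarrow> (u, v) \<in> A \<Longrightarrow> (v, u) \<notin> A"
proof
  assume t: "tree_arcs A" and uv: "(u, v) \<in> A" and vu: "(v, u) \<in> A"
  have "(u, v) \<notin> (sym_arcs (A - {(u, v)}))\<^sup>*" using t uv by (auto simp: tree_arcs_def)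
  moreover have "u = v \<or> (u, v) \<in> sym_arcs (A - {(u, v)})" using vu by (auto simp: sym_arcs_def)
  ultimately show False by auto
qed

lemma tree_arcs_irrefl: "tree_arcs A \<Longrightarrow> (u, u) \<notin> A"
  using tree_arcs_asym by metis

text \<open>A directed walk back to \<open>p\<close> may be stopped at its first visit of \<open>p\<close>, before it could use
  an arc out of \<open>p\<close>.\<close>
lemma rtrancl_avoid_arc: "(x, p) \<in> A\<^sup>* \<Longrightarrow> (x, p) \<in> (A - {(p, q)})\<^sup>*"
proof (induction rule: converse_rtrancl_induct)
  case (step y z)
  show ?case
  proof (cases "y = p")
    case False
    then have "(y, z) \<in> A - {(p, q)}" using step by auto
    then show ?thesis using step.IH by (rule converse_rtrancl_into_rtrancl)
  qed simp
qed simp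

text \<open>A directed way back from \<open>q\<close> to \<open>p\<close> would bypass the bridge
  \<open>(p, q)\<close>.\<close>

lemma tree_arcs_acyclic:
  assumes "tree_arcs A" and "(p, q) \<in> A" shows "(q, p) \<notin> A\<^sup>*"
proof
  assume "(q, p) \<in> A\<^sup>*"
  then have "(q, p) \<in> (sym_arcs (A - {(p, q)}))\<^sup>*"
    using rtrancl_avoid_arc arcs_rtrancl_sym_arcs by fast
  with assms show False
    by (auto simp: tree_arcs_def dest: rtrancl_sym_arcs_sym)
qed

section \<open>Inner vertices, pointers and good edges\<close>

definition inner_verts :: "('a \<times> 'a) set \<Rightarrow> 'a set" where
  "inner_verts A = Domain A \<inter> Range A"

definition inner_arcs :: "('a \<times> 'a) set \<Rightarrow> ('a \<times> 'a) set" where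
  "inner_arcs A = A \<inter> inner_verts A \<times> inner_verts A"

lemma inner_verts_converse [simp]: "inner_verts (A\<inverse>) = inner_verts A"
  by (auto simp: inner_verts_def)

lemma inner_arcs_converse [simp]: "inner_arcs (A\<inverse>) = (inner_arcs A)\<inverse>"
  by (auto simp: inner_arcs_def)

lemma inner_arcs_subset: "inner_arcs A \<subseteq> A"
  by (auto simp: inner_arcs_def)

lemma inner_arcs_iff: "(p, q) \<in> inner_arcs A \<longleftrightarrow> (p, q) \<in> A \<and> p \<in> Range A \<and> q \<in> Domain A"
  by (auto simp: inner_arcs_def inner_verts_def)

text \<open>A compass is encoded by pointers to neighbours: \<open>e Y a\<close> is the end of the edge YE(a) and
  \<open>w Y a\<close> the beginning of YW(a). Exchanging West and East amounts to passing from \<open>A\<close> to \<open>A\<inverse>\<close>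
  and swapping \<open>e\<close> with \<open>w\<close>.\<close>

definition out_functional :: "('a \<times> 'a) set \<Rightarrow> bool" where
  "out_functional A \<longleftrightarrow> (\<forall>p q r. (p, q) \<in> A \<longrightarrow> (p, r) \<in> A \<longrightarrow> p \<notin> Range A \<longrightarrow> r = q)"

definition pointers :: "('a \<times> 'a) set \<Rightarrow> (vertical \<Rightarrow> 'a \<Rightarrow> 'a) \<Rightarrow> bool" where
  "pointers A e \<longleftrightarrow> (\<forall>Y. \<forall>a\<in>inner_verts A. (a, e Y a) \<in> A)"

text \<open>Degree at least 2 is expressed by two distinct out-neighbours, so that no cardinality
  has to be followed through a cut.\<close>

definition separating :: "('a \<times> 'a) set \<Rightarrow> (vertical \<Rightarrow> 'a \<Rightarrow> 'a) \<Rightarrow> bool" where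
  "separating A e \<longleftrightarrow> (\<forall>a\<in>inner_verts A. \<forall>p q. (a, p) \<in> A \<longrightarrow> (a, q) \<in> A \<longrightarrow> p \<noteq> q \<longrightarrow>
     e North a \<noteq> e South a)"

text \<open>The first conjunct treats paths with two vertices, the second one the longer paths.\<close>
definition decent_pointers :: "('a \<times> 'a) set \<Rightarrow> ('a \<Rightarrow> 'a) \<Rightarrow> ('a \<Rightarrow> 'a) \<Rightarrow> bool" where
  "decent_pointers A e w \<longleftrightarrow>
     (\<forall>p q. (p, q) \<in> inner_arcs A \<longrightarrow> e p = q \<or> w q = p) \<and>
     (\<forall>p p' q' q. (p, p') \<in> inner_arcs A \<longrightarrow> (p', q') \<in> (inner_arcs A)\<^sup>* \<longrightarrow>
        (q', q) \<in> inner_arcs A \<longrightarrow> e p = p' \<or> w q = q')"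

lemma decent_pointers_converse: "decent_pointers A e w \<Longrightarrow> decent_pointers (A\<inverse>) w e"
  unfolding decent_pointers_def by (simp add: rtrancl_converse) blast

text \<open>The conditions on a local compass graph, stated for the bare set of arcs and arranged to
  be invariant under reversal of all arcs.\<close>

definition kgraph :: "('a \<times> 'a) set \<Rightarrow> (vertical \<Rightarrow> 'a \<Rightarrow> 'a) \<Rightarrow> (vertical \<Rightarrow> 'a \<Rightarrow> 'a) \<Rightarrow> bool" where
  "kgraph A e w \<longleftrightarrow> finite A \<and> tree_arcs A \<and> inner_verts A \<noteq> {} \<and>
     out_functional A \<and> out_functional (A\<inverse>) \<and>
     pointers A e \<and> pointers (A\<inverse>) w \<and> separating A e \<and> separating (A\<inverse>) w \<and>
     (\<forall>Y. decent_pointers A (e Y) (w Y))"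

lemma kgraph_converse: "kgraph A e w \<Longrightarrow> kgraph (A\<inverse>) w e"
  unfolding kgraph_def by (simp add: tree_arcs_converse decent_pointers_converse)

text \<open>If \<open>p\<close> were a W-vertex, functionality on both sides would make
  \<open>{p, q}\<close> a component of its own, leaving no room for an inner vertex in a connected
  graph.\<close>

lemma kgraph_domain_inner:
  assumes k: "kgraph A e w" and pq: "(p, q) \<in> A" and q: "q \<notin> Domain A"
  shows "p \<in> Range A"
proof (rule ccontr)
  assume p: "p \<notin> Range A"
  obtain x where x: "x \<in> Domain A" "x \<in> Range A" using k by (auto simp: kgraph_def inner_verts_def)
  have px: "(p, x) \<in> (sym_arcs A)\<^sup>*"
    using k pq x by (auto simp: kgraph_def tree_arcs_def Field_def)
  have "r = p \<longleftrightarrow> s = q" if "(r, s) \<in> A" for r s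
    using k pq that p q unfolding kgraph_def out_functional_def
    by (metis converse_iff Range_converse)
  then have "r \<in> {p, q} \<longleftrightarrow> s \<in> {p, q}" if "(r, s) \<in> A" for r s
    using that p q by blast
  with px have "x \<in> {p, q}" by (intro rtrancl_sym_arcs_closed[of p x A "{p, q}"]) auto
  then show False using x p q by auto
qed

text \<open>\<open>Y\<close>-pointers from every inner vertex on the way to \<open>x\<close> lead to the E-edge \<open>(x, y)\<close>.
  The distinguished edge YE of a construction is characterised by this condition.\<close>
definition good :: "('a \<times> 'a) set \<Rightarrow> ('a \<Rightarrow> 'a) \<Rightarrow> 'a \<Rightarrow> 'a \<Rightarrow> bool" where
  "good A e x y \<longleftrightarrow> (x, y) \<in> A \<and> x \<in> Range A \<and> y \<notin> Domain A \<and> e x = y \<and>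
     (\<forall>z z'. (z, z') \<in> inner_arcs A \<longrightarrow> (z', x) \<in> (inner_arcs A)\<^sup>* \<longrightarrow> e z = z')"

section \<open>Cutting a tree at an edge\<close>

text \<open>Read from \<open>AW\<close> and \<open>AE\<close> to \<open>A\<close> this is gluing,
  read backwards it is splitting at \<open>(a, d)\<close>. Requiring \<open>a\<close> and
  \<open>d\<close> to be inner in their halves makes \<open>(a, d)\<close> an inner arc of
  \<open>A\<close>. Reversal of arcs exchanges the halves, \<open>a\<close> with \<open>d\<close>,
  and \<open>b\<close> with \<open>c\<close>.\<close>

locale cutting =
  fixes AW AE :: "('a \<times> 'a) set" and a b c d :: 'a and A :: "('a \<times> 'a) set"
  assumes disj: "Field AW \<inter> Field AE = {}"
    and ab: "(a, b) \<in> AW" "a \<in> Range AW" "b \<notin> Domain AW" "\<And>x. (x, b) \<in> AW \<longleftrightarrow> x = a"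
    and cd: "(c, d) \<in> AE" "d \<in> Domain AE" "c \<notin> Range AE" "\<And>x. (c, x) \<in> AE \<longleftrightarrow> x = d"
    and A_eq: "A = (AW - {(a, b)}) \<union> (AE - {(c, d)}) \<union> {(a, d)}"
begin

lemma cutting_dual: "cutting (AE\<inverse>) (AW\<inverse>) d c b a (A\<inverse>)"
proof unfold_locales
  show "Field (AE\<inverse>) \<inter> Field (AW\<inverse>) = {}" using disj by auto
  show "A\<inverse> = AE\<inverse> - {(d, c)} \<union> (AW\<inverse> - {(b, a)}) \<union> {(d, a)}" unfolding A_eq by auto
qed (use ab cd in auto)

lemma outside [simp]: "d \<notin> Field AW" "c \<notin> Field AW" "a \<notin> Field AE" "b \<notin> Field AE"
  using disj ab(1) cd(1) by (auto simp: Field_def)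

lemma inside [simp]: "a \<in> Field AW" "b \<in> Field AW" "c \<in> Field AE" "d \<in> Field AE"
  using ab(1) cd(1) by (auto simp: Field_def)

lemma distinct_ends: "a \<noteq> b" "c \<noteq> d"
  using ab cd by auto

lemma AW_Field: "(p, q) \<in> AW \<Longrightarrow> p \<in> Field AW \<and> q \<in> Field AW \<and> p \<notin> Field AE \<and> q \<notin> Field AE"
  and AE_Field: "(p, q) \<in> AE \<Longrightarrow> p \<in> Field AE \<and> q \<in> Field AE \<and> p \<notin> Field AW \<and> q \<notin> Field AW"
  using disj by (auto simp: Field_def)

lemma Range_A: "Range A = (Range AW - {b}) \<union> Range AE"
proof -
  have "b \<notin> Range AE" "Range (AW - {(a, b)}) = Range AW - {b}"
    using ab outside by (auto simp: Field_def)
  moreover have "Range AE = insert d (Range (AE - {(c, d)}))" using cd by auto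
  ultimately show ?thesis unfolding A_eq by auto
qed

lemma Domain_A: "Domain A = Domain AW \<union> (Domain AE - {c})"
  using cutting.Range_A[OF cutting_dual] by auto

lemma inner_verts_A: "inner_verts A = inner_verts AW \<union> inner_verts AE"
proof -
  have "Domain AW \<inter> Range AE = {}" "Domain AE \<inter> Range AW = {}"
    using disj by (auto simp: Field_def)
  then show ?thesis
    using ab cd unfolding inner_verts_def Range_A Domain_A by blast
qed

text \<open>Inner arcs of the halves are untouched because \<open>b\<close> and \<open>c\<close> are
  not inner; the only new one leads from West to East. Hence inner paths cross at most once, and
  both halves have fewer inner arcs than \<open>A\<close>.\<close>

lemma inner_arcs_A: "inner_arcs A = inner_arcs AW \<union> inner_arcs AE \<union> {(a, d)}"
proof -
  have mem: "a \<in> inner_verts AW" "d \<in> inner_verts AE"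
    and notin: "b \<notin> inner_verts AW" "c \<notin> inner_verts AE"
    and sub: "\<And>x. x \<in> inner_verts AW \<Longrightarrow> x \<notin> Field AE" "\<And>x. x \<in> inner_verts AE \<Longrightarrow> x \<notin> Field AW"
    using ab(2,3) cd(2,3) disj DomainI[OF ab(1)] RangeI[OF cd(1)] by (auto simp: inner_verts_def Field_def)
  have "(p, q) \<in> inner_arcs A \<longleftrightarrow> (p, q) \<in> inner_arcs AW \<union> inner_arcs AE \<union> {(a, d)}" for p q
  proof -
    have "(p, q) \<in> A \<longleftrightarrow>
        (p, q) \<in> AW \<and> (p, q) \<noteq> (a, b) \<or> (p, q) \<in> AE \<and> (p, q) \<noteq> (c, d) \<or> (p, q) = (a, d)"
      unfolding A_eq by auto
    then show ?thesis
      unfolding inner_arcs_def inner_verts_A using mem notin sub AW_Field[of p q] AE_Field[of p q]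
      by auto
  qed
  then show ?thesis by auto
qed

lemma inner_arcs_W: "(p, q) \<in> inner_arcs AW \<Longrightarrow> p \<in> Field AW \<and> q \<in> Field AW \<and> p \<noteq> d \<and> q \<noteq> d \<and> q \<noteq> b"
  using AW_Field[of p q] outside(1) ab(3) inner_arcs_iff[of p q AW] by metis

lemma inner_arcs_E: "(p, q) \<in> inner_arcs AE \<Longrightarrow> p \<in> Field AE \<and> q \<in> Field AE \<and> p \<noteq> a \<and> q \<noteq> a \<and> p \<noteq> c"
  using AE_Field[of p q] outside(3) cd(3) inner_arcs_iff[of p q AE] by metis

text \<open>Connectedness: renaming \<open>b\<close> to \<open>d\<close>, or \<open>c\<close> to
  \<open>a\<close>, maps each half into \<open>A\<close>. Bridges: a bypass of an arc of one half
  survives the contraction of the other half to the end that was cut off.\<close>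

lemma tree_arcs_A:
  assumes W: "tree_arcs AW" and E: "tree_arcs AE" shows "tree_arcs A"
  unfolding tree_arcs_def
proof (intro conjI ballI allI impI)
  have "(u, a) \<in> (sym_arcs A)\<^sup>*" if "u \<in> Field AW" "u \<noteq> b" for u
  proof -
    define f where "f x = (if x = b then d else x)" for x
    have "(u, a) \<in> (sym_arcs AW)\<^sup>*" using W that by (auto simp: tree_arcs_def)
    then have "(f u, f a) \<in> (sym_arcs A)\<^sup>*"
    proof (rule rtrancl_sym_arcs_hom)
      fix p q assume pq: "(p, q) \<in> AW"
      then have "p \<noteq> b" using ab by auto
      then have "(f p, f q) \<in> A" using pq ab(4) unfolding A_eq f_def by auto
      then show "(f p, f q) \<in> (sym_arcs A)\<^sup>*" by (auto simp: sym_arcs_def)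
    qed
    then show ?thesis using that distinct_ends by (simp add: f_def)
  qed
  moreover have "(u, d) \<in> (sym_arcs A)\<^sup>*" if "u \<in> Field AE" "u \<noteq> c" for u
  proof -
    define f where "f x = (if x = c then a else x)" for x
    have "(u, d) \<in> (sym_arcs AE)\<^sup>*" using E that by (auto simp: tree_arcs_def)
    then have "(f u, f d) \<in> (sym_arcs A)\<^sup>*"
    proof (rule rtrancl_sym_arcs_hom)
      fix p q assume pq: "(p, q) \<in> AE"
      then have "q \<noteq> c" using cd by auto
      then have "(f p, f q) \<in> A" using pq cd(4) unfolding A_eq f_def by auto
      then show "(f p, f q) \<in> (sym_arcs A)\<^sup>*" by (auto simp: sym_arcs_def)
    qed
    then show ?thesis using that distinct_ends by (simp add: f_def)
  qed
  moreover have "(d, a) \<in> (sym_arcs A)\<^sup>*" by (auto simp: sym_arcs_def A_eq)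
  moreover have "u \<in> Field AW \<and> u \<noteq> b \<or> u \<in> Field AE \<and> u \<noteq> c" if "u \<in> Field A" for u
    using that ab cd unfolding Field_def Range_A Domain_A by auto
  ultimately have *: "(u, a) \<in> (sym_arcs A)\<^sup>*" if "u \<in> Field A" for u
    using that by (meson rtrancl_trans)
  show "(u, v) \<in> (sym_arcs A)\<^sup>*" if "u \<in> Field A" "v \<in> Field A" for u v
    using *[OF that(1)] *[OF that(2)] by (meson rtrancl_trans rtrancl_sym_arcs_sym)
next
  fix u v assume uv: "(u, v) \<in> A"
  show "(u, v) \<notin> (sym_arcs (A - {(u, v)}))\<^sup>*"
  proof
    assume r: "(u, v) \<in> (sym_arcs (A - {(u, v)}))\<^sup>*"
    consider "(u, v) \<in> AW" "(u, v) \<noteq> (a, b)" | "(u, v) \<in> AE" "(u, v) \<noteq> (c, d)" | "u = a" "v = d"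
      using uv unfolding A_eq by auto
    then show False
    proof cases
      case 1
      \<comment> \<open>The East half collapses to \<open>b\<close>, which turns the new arc
        \<open>(a, d)\<close> back into \<open>(a, b)\<close>.\<close>
      define f where "f x = (if x \<in> Field AE then b else x)" for x
      have "(f u, f v) \<in> (sym_arcs (AW - {(u, v)}))\<^sup>*"
        using r
      proof (rule rtrancl_sym_arcs_hom)
        fix p q assume pq: "(p, q) \<in> A - {(u, v)}"
        then have "f p = f q \<or> (f p, f q) \<in> AW - {(u, v)}"
          using 1 AW_Field AE_Field ab(1) unfolding A_eq f_def by auto
        then show "(f p, f q) \<in> (sym_arcs (AW - {(u, v)}))\<^sup>*" by (auto simp: sym_arcs_def)
      qed
      then show False using W 1 AW_Field by (auto simp: f_def tree_arcs_def)
    next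
      case 2
      define f where "f x = (if x \<in> Field AW then c else x)" for x
      have "(f u, f v) \<in> (sym_arcs (AE - {(u, v)}))\<^sup>*"
        using r
      proof (rule rtrancl_sym_arcs_hom)
        fix p q assume pq: "(p, q) \<in> A - {(u, v)}"
        then have "f p = f q \<or> (f p, f q) \<in> AE - {(u, v)}"
          using 2 AW_Field AE_Field cd(1) unfolding A_eq f_def by auto
        then show "(f p, f q) \<in> (sym_arcs (AE - {(u, v)}))\<^sup>*" by (auto simp: sym_arcs_def)
      qed
      then show False using E 2 AE_Field by (auto simp: f_def tree_arcs_def)
    next
      case 3
      \<comment> \<open>Once \<open>(a, d)\<close> is deleted, no arc leaves the vertices of the
        West half.\<close>
      have "v \<in> Field AW"
        using r by (rule rtrancl_sym_arcs_closed) (use 3 AW_Field AE_Field in \<open>auto simp: A_eq\<close>)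
      then show False using 3 by simp
    qed
  qed
qed

lemma tree_arcs_W:
  assumes A: "tree_arcs A" shows "tree_arcs AW"
  unfolding tree_arcs_def
proof (intro conjI ballI allI impI)
  have *: "(u, a) \<in> (sym_arcs AW)\<^sup>*" if u: "u \<in> Field AW" for u
  proof (cases "u = b")
    case True
    then show ?thesis using ab(1) by (auto simp: sym_arcs_def)
  next
    case False
    define f where "f x = (if x \<in> Field AE then b else x)" for x
    have "u \<in> Field A" "a \<in> Field A"
      using False u ab unfolding Field_def Domain_A Range_A by auto
    then have "(u, a) \<in> (sym_arcs A)\<^sup>*" using A by (auto simp: tree_arcs_def)
    then have "(f u, f a) \<in> (sym_arcs AW)\<^sup>*"
    proof (rule rtrancl_sym_arcs_hom)
      fix p q assume "(p, q) \<in> A"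
      then have "f p = f q \<or> (f p, f q) \<in> AW"
        using AW_Field AE_Field ab(1) unfolding A_eq f_def by auto
      then show "(f p, f q) \<in> (sym_arcs AW)\<^sup>*" by (auto simp: sym_arcs_def)
    qed
    moreover have "u \<notin> Field AE" using u disj by auto
    ultimately show ?thesis by (simp add: f_def)
  qed
  show "(u, v) \<in> (sym_arcs AW)\<^sup>*" if "u \<in> Field AW" "v \<in> Field AW" for u v
    using *[OF that(1)] *[OF that(2)] by (meson rtrancl_trans rtrancl_sym_arcs_sym)
next
  fix u v assume uv: "(u, v) \<in> AW"
  show "(u, v) \<notin> (sym_arcs (AW - {(u, v)}))\<^sup>*"
  proof
    assume r: "(u, v) \<in> (sym_arcs (AW - {(u, v)}))\<^sup>*"
    show False
    proof (cases "v = b")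
      case True
      then have "u = a" using uv ab(4) by simp
      \<comment> \<open>\<open>b\<close> is a leaf, so deleting its only arc isolates it.\<close>
      have "v \<in> - {b}" using r
        by (rule rtrancl_sym_arcs_closed)
          (use True \<open>u = a\<close> ab distinct_ends in auto)
      then show False using True by simp
    next
      case False
      define f where "f x = (if x = b then d else x)" for x
      have "(f u, f v) \<in> (sym_arcs (A - {(u, v)}))\<^sup>*"
        using r
      proof (rule rtrancl_sym_arcs_hom)
        fix p q assume pq: "(p, q) \<in> AW - {(u, v)}"
        then have "p \<noteq> b" using ab by auto
        moreover have "v \<noteq> d" using uv AW_Field outside(1) by metis
        ultimately have "(f p, f q) \<in> A - {(u, v)}" using pq ab(4) unfolding A_eq f_def by auto
        then show "(f p, f q) \<in> (sym_arcs (A - {(u, v)}))\<^sup>*" by (auto simp: sym_arcs_def)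
      qed
      moreover have "u \<noteq> b" using uv ab by auto
      ultimately have "(u, v) \<in> (sym_arcs (A - {(u, v)}))\<^sup>*" using False by (simp add: f_def)
      moreover have "(u, v) \<in> A" using uv False unfolding A_eq by auto
      ultimately show False using A by (auto simp: tree_arcs_def)
    qed
  qed
qed

text \<open>The only arcs that change begin in \<open>a\<close>, which is not a W-vertex, or in
  \<open>c\<close>, which has a single arc and disappears.\<close>

lemma out_functional_A: "out_functional A \<longleftrightarrow> out_functional AW \<and> out_functional AE"
proof (intro iffI conjI)
  assume A: "out_functional A"
  have "a \<in> Range A" using ab distinct_ends by (simp add: Range_A)
  show "out_functional AW" unfolding out_functional_def
  proof (intro allI impI)
    fix p q r assume h: "(p, q) \<in> AW" "(p, r) \<in> AW" "p \<notin> Range AW"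
    then have "p \<noteq> a" "p \<notin> Range A" using ab AW_Field unfolding Range_A by (auto simp: Field_def)
    moreover have "(p, q) \<in> A" "(p, r) \<in> A" using h \<open>p \<noteq> a\<close> unfolding A_eq by auto
    ultimately show "r = q" using A unfolding out_functional_def by blast
  qed
  show "out_functional AE" unfolding out_functional_def
  proof (intro allI impI)
    fix p q r assume h: "(p, q) \<in> AE" "(p, r) \<in> AE" "p \<notin> Range AE"
    show "r = q"
    proof (cases "p = c")
      case False
      then have "p \<notin> Range A" using h AE_Field unfolding Range_A by (auto simp: Field_def)
      moreover have "(p, q) \<in> A" "(p, r) \<in> A" using h False unfolding A_eq by auto
      ultimately show "r = q" using A unfolding out_functional_def by blast
    qed (use h cd(4) in simp)
  qed
next
  assume WE: "out_functional AW \<and> out_functional AE"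
  show "out_functional A" unfolding out_functional_def
  proof (intro allI impI)
    fix p q r assume h: "(p, q) \<in> A" "(p, r) \<in> A" "p \<notin> Range A"
    have "p \<noteq> a" using h ab distinct_ends unfolding Range_A by auto
    with h(1,2) consider "(p, q) \<in> AW" "(p, r) \<in> AW" | "(p, q) \<in> AE" "(p, r) \<in> AE"
      using AW_Field AE_Field unfolding A_eq by blast
    then show "r = q"
    proof cases
      case 1
      then have "p \<notin> Range AW" using h(3) ab unfolding Range_A by auto
      then show ?thesis using 1 WE unfolding out_functional_def by blast
    next
      case 2
      then have "p \<notin> Range AE" using h(3) unfolding Range_A by auto
      then show ?thesis using 2 WE unfolding out_functional_def by blast
    qed
  qed
qed

text \<open>Only \<open>(a, d)\<close> joins the halves, and it is directed from West to East: a
  path stays in its half or splits at \<open>(a, d)\<close>, and never returns.\<close>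

lemma rtrancl_inner_arcs_A:
  assumes "(p, q) \<in> (inner_arcs A)\<^sup>*"
  shows "(p \<in> Field AW \<longrightarrow> q \<in> Field AW \<longrightarrow> (p, q) \<in> (inner_arcs AW)\<^sup>*) \<and>
    (p \<in> Field AW \<longrightarrow> q \<in> Field AE \<longrightarrow> (p, a) \<in> (inner_arcs AW)\<^sup>* \<and> (d, q) \<in> (inner_arcs AE)\<^sup>*) \<and>
    (p \<in> Field AE \<longrightarrow> q \<in> Field AE \<and> (p, q) \<in> (inner_arcs AE)\<^sup>*)"
  using assms
proof induction
  case base
  then show ?case using disj by auto
next
  case (step q r)
  consider "(q, r) \<in> inner_arcs AW" "q \<in> Field AW" "q \<notin> Field AE" "r \<in> Field AW" "r \<notin> Field AE"
    | "(q, r) \<in> inner_arcs AE" "q \<in> Field AE" "q \<notin> Field AW" "r \<in> Field AE" "r \<notin> Field AW"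
    | "q = a" "r = d"
    using step.hyps(2) AW_Field AE_Field inner_arcs_subset unfolding inner_arcs_A by blast
  then show ?case
    by cases (use step.IH in \<open>auto intro: rtrancl_into_rtrancl\<close>)
qed

lemma inner_arcs_W_rtrancl: "(inner_arcs AW)\<^sup>* \<subseteq> (inner_arcs A)\<^sup>*"
  and inner_arcs_E_rtrancl: "(inner_arcs AE)\<^sup>* \<subseteq> (inner_arcs A)\<^sup>*"
  by (rule rtrancl_mono; auto simp: inner_arcs_A)+

end

text \<open>\<open>f\<close> stands for YW and \<open>g\<close> for YE of a construction of \<open>A\<close>.\<close>
definition main_edges ::
  "('a \<times> 'a) set \<Rightarrow> ('a \<Rightarrow> 'a) \<Rightarrow> ('a \<Rightarrow> 'a) \<Rightarrow> 'a \<times> 'a \<Rightarrow> 'a \<times> 'a \<Rightarrow> bool" where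
  "main_edges A e w f g \<longleftrightarrow> good A e (fst g) (snd g) \<and> good (A\<inverse>) w (snd f) (fst f) \<and>
     (snd f, fst g) \<in> (inner_arcs A)\<^sup>* \<and>
     (\<forall>x y. good A e x y \<longrightarrow> (x, y) = g) \<and> (\<forall>s t. good (A\<inverse>) w t s \<longrightarrow> (s, t) = f)"

text \<open>Pointers at the omitted vertices are redirected: from \<open>b\<close> to
  \<open>d\<close>, and from \<open>c\<close> to \<open>a\<close>. These are equations rather than
  definitions because gluing defines \<open>e\<close> and \<open>w\<close> from the halves, while
  splitting defines \<open>eW\<close> and \<open>wE\<close> from \<open>e\<close> and
  \<open>w\<close>.\<close>

locale cutting_pointers = cutting +
  fixes e eW eE w wW wE :: "vertical \<Rightarrow> 'a \<Rightarrow> 'a"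
  assumes ptr_e: "pointers AW eW" "pointers AE eE"
    and ptr_w: "pointers (AE\<inverse>) wE" "pointers (AW\<inverse>) wW"
    and e_W: "\<And>Y z. z \<in> inner_verts AW \<Longrightarrow> e Y z = (if eW Y z = b then d else eW Y z)"
    and e_E: "\<And>Y z. z \<in> inner_verts AE \<Longrightarrow> e Y z = eE Y z"
    and w_E: "\<And>Y z. z \<in> inner_verts AE \<Longrightarrow> w Y z = (if wE Y z = c then a else wE Y z)"
    and w_W: "\<And>Y z. z \<in> inner_verts AW \<Longrightarrow> w Y z = wW Y z"
begin

lemma cutting_pointers_dual: "cutting_pointers (AE\<inverse>) (AW\<inverse>) d c b a (A\<inverse>) w wE wW e eE eW"
  by (intro cutting_pointers.intro cutting_dual cutting_pointers_axioms.intro)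
    (simp_all add: ptr_e ptr_w e_W e_E w_W w_E)

section \<open>Pointers and decency across a cut\<close>

lemma eW_arc: "z \<in> inner_verts AW \<Longrightarrow> (z, eW Y z) \<in> AW"
  using ptr_e by (auto simp: pointers_def)

lemma eE_arc: "z \<in> inner_verts AE \<Longrightarrow> (z, eE Y z) \<in> AE"
  using ptr_e by (auto simp: pointers_def)

lemma a_inner: "a \<in> inner_verts AW"
  using ab(2) DomainI[OF ab(1)] by (auto simp: inner_verts_def)

lemma e_arc_W: "(z, z') \<in> inner_arcs AW \<Longrightarrow> e Y z = z' \<longleftrightarrow> eW Y z = z'"
  using inner_arcs_W[of z z'] e_W[of z Y] by (auto simp: inner_arcs_def)

lemma e_arc_E: "(z, z') \<in> inner_arcs AE \<Longrightarrow> e Y z = z' \<longleftrightarrow> eE Y z = z'"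
  using e_E[of z Y] by (auto simp: inner_arcs_def)

lemma eW_neq_d: "z \<in> inner_verts AW \<Longrightarrow> eW Y z \<noteq> d"
  using eW_arc[of z Y] AW_Field outside(1) by metis

lemma e_a: "e Y a = d \<longleftrightarrow> eW Y a = b"
  using e_W[OF a_inner, of Y] eW_neq_d[OF a_inner, of Y] by auto

lemma pointers_A: "pointers A e"
  unfolding pointers_def
proof (intro allI ballI)
  fix Y z assume "z \<in> inner_verts A"
  then consider "z \<in> inner_verts AW" | "z \<in> inner_verts AE" using inner_verts_A by auto
  then show "(z, e Y z) \<in> A"
  proof cases
    case 1
    show ?thesis
    proof (cases "eW Y z = b")
      case True
      then have "z = a" using eW_arc[OF 1, of Y] ab(4) by simp
      then show ?thesis using True e_a unfolding A_eq by simp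
    next
      case False
      then show ?thesis using eW_arc[OF 1, of Y] e_W[OF 1] unfolding A_eq by simp
    qed
  next
    case 2
    then have "z \<noteq> c" using cd(3) by (auto simp: inner_verts_def)
    then show ?thesis using eE_arc[OF 2, of Y] e_E[OF 2] unfolding A_eq by simp
  qed
qed

text \<open>Renaming \<open>b\<close> to \<open>d\<close> merges no two out-neighbours, since
  \<open>d\<close> lies outside \<open>AW\<close>, and it carries the pointers of \<open>AW\<close>
  to those of \<open>A\<close>.\<close>

lemma separating_W: "separating A e \<Longrightarrow> separating AW eW"
  unfolding separating_def
proof (intro ballI allI impI)
  fix z p q
  assume A: "\<forall>z\<in>inner_verts A. \<forall>p q. (z, p) \<in> A \<longrightarrow> (z, q) \<in> A \<longrightarrow> p \<noteq> q \<longrightarrow> e North z \<noteq> e South z"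
    and z: "z \<in> inner_verts AW" and pq: "(z, p) \<in> AW" "(z, q) \<in> AW" "p \<noteq> q"
  define f where "f x = (if x = b then d else x)" for x
  have *: "(z, f r) \<in> A" if "(z, r) \<in> AW" for r
    using that ab(4) unfolding A_eq f_def by auto
  have "f p \<noteq> f q" using pq AW_Field outside(1) unfolding f_def by metis
  then have "e North z \<noteq> e South z" using A z * pq inner_verts_A by blast
  then show "eW North z \<noteq> eW South z" using e_W[OF z] by metis
qed

lemma separating_E: "separating A e \<Longrightarrow> separating AE eE"
  unfolding separating_def
proof (intro ballI allI impI)
  fix z p q
  assume A: "\<forall>z\<in>inner_verts A. \<forall>p q. (z, p) \<in> A \<longrightarrow> (z, q) \<in> A \<longrightarrow> p \<noteq> q \<longrightarrow> e North z \<noteq> e South z"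
    and z: "z \<in> inner_verts AE" and pq: "(z, p) \<in> AE" "(z, q) \<in> AE" "p \<noteq> q"
  have "z \<noteq> c" using z cd(3) by (auto simp: inner_verts_def)
  then have "(z, p) \<in> A" "(z, q) \<in> A" using pq unfolding A_eq by auto
  then have "e North z \<noteq> e South z" using A z pq(3) inner_verts_A by blast
  then show "eE North z \<noteq> eE South z" using e_E[OF z] by metis
qed

lemma separating_A:
  assumes W: "separating AW eW" and E: "separating AE eE" shows "separating A e"
  unfolding separating_def
proof (intro ballI allI impI)
  fix z p q assume z: "z \<in> inner_verts A" and pq: "(z, p) \<in> A" "(z, q) \<in> A" "p \<noteq> q"
  from z consider "z \<in> inner_verts AW" | "z \<in> inner_verts AE" using inner_verts_A by auto
  then show "e North z \<noteq> e South z"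
  proof cases
    case 1
    have *: "\<exists>r'. (z, r') \<in> AW \<and> r = (if r' = b then d else r')" if zr: "(z, r) \<in> A" for r
    proof -
      have "(z, r) \<notin> AE" using eW_arc[OF 1] AW_Field AE_Field by metis
      then consider "(z, r) \<in> AW" "(z, r) \<noteq> (a, b)" | "z = a" "r = d"
        using zr unfolding A_eq by auto
      then show ?thesis
      proof cases
        case 1
        then have "r \<noteq> b" using ab(4) by auto
        then show ?thesis using 1 by auto
      next
        case 2
        then show ?thesis using ab(1) by metis
      qed
    qed
    obtain p' q' where "(z, p') \<in> AW" "(z, q') \<in> AW" "p' \<noteq> q'"
      using *[OF pq(1)] *[OF pq(2)] pq(3) by metis
    then have "eW North z \<noteq> eW South z" using W 1 unfolding separating_def by blast
    then show ?thesis using e_W[OF 1] eW_neq_d[OF 1] by metis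
  next
    case 2
    have "z \<noteq> a" using eE_arc[OF 2] AE_Field outside(3) by metis
    moreover have "(z, r) \<notin> AW" for r using eE_arc[OF 2] AW_Field AE_Field by metis
    ultimately have "(z, p) \<in> AE" "(z, q) \<in> AE" using pq unfolding A_eq by auto
    then have "eE North z \<noteq> eE South z" using E 2 pq(3) unfolding separating_def by blast
    then show ?thesis using e_E[OF 2] by metis
  qed
qed

text \<open>A path from West to East passes through \<open>a\<close>, so its first arc either leads
  to \<open>a\<close> and is governed by the goodness of \<open>(a, b)\<close>, or is
  \<open>(a, d)\<close>, the redirected \<open>(a, b)\<close>.\<close>

lemma good_crossing:
  assumes g: "good AW (eW Y) a b" and pp: "(p, p') \<in> inner_arcs A"
    and path: "(p', q) \<in> (inner_arcs A)\<^sup>*" and p: "p \<in> Field AW" and q: "q \<in> Field AE"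
  shows "e Y p = p'"
proof -
  consider "(p, p') \<in> inner_arcs AW" | "p = a" "p' = d"
    using pp p AE_Field inner_arcs_subset[of AE] unfolding inner_arcs_A by blast
  then show ?thesis
  proof cases
    case 1
    then have "(p', a) \<in> (inner_arcs AW)\<^sup>*"
      using rtrancl_inner_arcs_A[OF path] q inner_arcs_W by metis
    then have "eW Y p = p'" using g 1 unfolding good_def by blast
    then show ?thesis using e_arc_W[OF 1] by simp
  next
    case 2
    then show ?thesis using g e_a unfolding good_def by simp
  qed
qed

lemma good_crossing_dual:
  assumes "good (AE\<inverse>) (wE Y) d c" "(q', q) \<in> inner_arcs A" "(p, q') \<in> (inner_arcs A)\<^sup>*"
    "p \<in> Field AW" "q \<in> Field AE"
  shows "w Y q = q'"
  using cutting_pointers.good_crossing[OF cutting_pointers_dual assms(1), of q q' p] assms(2-)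
  by (simp add: rtrancl_converse)

text \<open>A path that crosses the cut is decent by way of whichever of the two cut edges is good.\<close>
lemma decent_A:
  assumes W: "decent_pointers AW (eW Y) (wW Y)" and E: "decent_pointers AE (eE Y) (wE Y)"
    and g: "good AW (eW Y) a b \<or> good (AE\<inverse>) (wE Y) d c"
  shows "decent_pointers A (e Y) (w Y)"
proof -
  interpret dual: cutting_pointers "AE\<inverse>" "AW\<inverse>" d c b a "A\<inverse>" w wE wW e eE eW
    by (rule cutting_pointers_dual)
  have w_arc_E: "w Y q = q' \<longleftrightarrow> wE Y q = q'" if "(q', q) \<in> inner_arcs AE" for q q'
    using dual.e_arc_W[of q q' Y] that by simp
  have w_arc_W: "w Y q = q' \<longleftrightarrow> wW Y q = q'" if "(q', q) \<in> inner_arcs AW" for q q'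
    using dual.e_arc_E[of q q' Y] that by simp
  have cross: "e Y p = p' \<or> w Y q = q'"
    if "(p, p') \<in> inner_arcs A" "(q', q) \<in> inner_arcs A"
      "(p', q) \<in> (inner_arcs A)\<^sup>*" "(p, q') \<in> (inner_arcs A)\<^sup>*" "p \<in> Field AW" "q \<in> Field AE"
    for p p' q' q
    using g good_crossing good_crossing_dual that by metis
  show ?thesis
    unfolding decent_pointers_def
  proof (intro conjI allI impI)
    fix p q assume pq: "(p, q) \<in> inner_arcs A"
    then consider "(p, q) \<in> inner_arcs AW" | "(p, q) \<in> inner_arcs AE" | "p = a" "q = d"
      unfolding inner_arcs_A by blast
    then show "e Y p = q \<or> w Y q = p"
    proof cases
      case 1
      then have "eW Y p = q \<or> wW Y q = p" using W unfolding decent_pointers_def by blast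
      then show ?thesis using e_arc_W[OF 1] w_arc_W[OF 1] by simp
    next
      case 2
      then have "eE Y p = q \<or> wE Y q = p" using E unfolding decent_pointers_def by blast
      then show ?thesis using e_arc_E[OF 2] w_arc_E[OF 2] by simp
    next
      case 3
      show ?thesis by (rule cross[OF pq pq]) (simp_all add: 3)
    qed
  next
    fix p p' q' q
    assume pp: "(p, p') \<in> inner_arcs A" and path: "(p', q') \<in> (inner_arcs A)\<^sup>*"
      and qq: "(q', q) \<in> inner_arcs A"
    have paths: "(p', q) \<in> (inner_arcs A)\<^sup>*" "(p, q') \<in> (inner_arcs A)\<^sup>*"
      using pp path qq by (auto intro: rtrancl_into_rtrancl converse_rtrancl_into_rtrancl)
    have side: "(r, s) \<in> inner_arcs AW \<and> r \<in> Field AW \<and> s \<in> Field AW \<or>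
        (r, s) \<in> inner_arcs AE \<and> r \<in> Field AE \<and> s \<in> Field AE \<or> r = a \<and> s = d"
      if "(r, s) \<in> inner_arcs A" for r s
      using that inner_arcs_W[of r s] inner_arcs_E[of r s] unfolding inner_arcs_A by blast
    consider "p \<in> Field AW" "q \<in> Field AE"
      | "p \<in> Field AW" "q \<in> Field AW" | "p \<in> Field AE"
      using side[OF pp] side[OF qq] inside(1,4) by metis
    then show "e Y p = p' \<or> w Y q = q'"
    proof cases
      case 1
      show ?thesis by (rule cross[OF pp qq paths 1])
    next
      case 2
      then have q: "(q', q) \<in> inner_arcs AW" "q' \<in> Field AW"
        using side[OF qq] disj outside(1) by blast+
      \<comment> \<open>A path that ends in the West half never left it.\<close>
      have "p' \<notin> Field AE"
        using rtrancl_inner_arcs_A[OF path] q(2) disj by blast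
      then have p: "(p, p') \<in> inner_arcs AW" "p' \<in> Field AW"
        using side[OF pp] inside(4) by blast+
      have "(p', q') \<in> (inner_arcs AW)\<^sup>*"
        using rtrancl_inner_arcs_A[OF path] p q by blast
      then have "eW Y p = p' \<or> wW Y q = q'"
        using W p q unfolding decent_pointers_def by blast
      then show ?thesis using e_arc_W[OF p(1)] w_arc_W[OF q(1)] by simp
    next
      case 3
      then have p: "(p, p') \<in> inner_arcs AE" "p' \<in> Field AE"
        using side[OF pp] disj outside(3) by blast+
      then have q': "q' \<in> Field AE" "(p', q') \<in> (inner_arcs AE)\<^sup>*"
        using rtrancl_inner_arcs_A[OF path] by blast+
      then have q: "(q', q) \<in> inner_arcs AE"
        using side[OF qq] disj outside(3) by blast
      then have "eE Y p = p' \<or> wE Y q = q'"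
        using E p q' unfolding decent_pointers_def by blast
      then show ?thesis using e_arc_E[OF p(1)] w_arc_E[OF q] by simp
    qed
  qed
qed

text \<open>Inner arcs of the half are inner arcs of \<open>A\<close>, and redirection does not
  affect whether a pointer follows such an arc; the conditions for \<open>AW\<close> are among those
  for \<open>A\<close>.\<close>

lemma decent_W:
  assumes A: "decent_pointers A (e Y) (w Y)" shows "decent_pointers AW (eW Y) (wW Y)"
proof -
  interpret dual: cutting_pointers "AE\<inverse>" "AW\<inverse>" d c b a "A\<inverse>" w wE wW e eE eW
    by (rule cutting_pointers_dual)
  have w_arc_W: "w Y q = q' \<longleftrightarrow> wW Y q = q'" if "(q', q) \<in> inner_arcs AW" for q q'
    using dual.e_arc_E[of q q' Y] that by simp
  have sub: "(p, q) \<in> inner_arcs A" if "(p, q) \<in> inner_arcs AW" for p q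
    using that by (simp add: inner_arcs_A)
  show ?thesis
    unfolding decent_pointers_def
  proof (intro conjI allI impI)
    fix p q assume pq: "(p, q) \<in> inner_arcs AW"
    then have "e Y p = q \<or> w Y q = p" using A sub unfolding decent_pointers_def by blast
    then show "eW Y p = q \<or> wW Y q = p" using e_arc_W[OF pq] w_arc_W[OF pq] by simp
  next
    fix p p' q' q
    assume p: "(p, p') \<in> inner_arcs AW" and path: "(p', q') \<in> (inner_arcs AW)\<^sup>*"
      and q: "(q', q) \<in> inner_arcs AW"
    have "e Y p = p' \<or> w Y q = q'"
      using A sub[OF p] sub[OF q] path inner_arcs_W_rtrancl unfolding decent_pointers_def by blast
    then show "eW Y p = p' \<or> wW Y q = q'" using e_arc_W[OF p] w_arc_W[OF q] by simp
  qed
qed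

text \<open>If neither cut edge were good, an edge violating goodness on the West side and one violating
  it on the East side would be the ends of an indecent path through \<open>(a, d)\<close>.\<close>
lemma decent_good:
  assumes A: "decent_pointers A (e Y) (w Y)"
  shows "good AW (eW Y) a b \<or> good (AE\<inverse>) (wE Y) d c"
proof (rule ccontr)
  assume n: "\<not> ?thesis"
  interpret dual: cutting_pointers "AE\<inverse>" "AW\<inverse>" d c b a "A\<inverse>" w wE wW e eE eW
    by (rule cutting_pointers_dual)
  have ad: "(a, d) \<in> inner_arcs A" by (simp add: inner_arcs_A)
  \<comment> \<open>The alternative \<open>(p, p') = (a, d)\<close> covers the case that the pointer
    of \<open>a\<close> itself misses \<open>b\<close>.\<close>
  have "\<exists>p p'. (p, p') \<in> inner_arcs A \<and> e Y p \<noteq> p' \<and>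
      ((p, p') = (a, d) \<or> (p', a) \<in> (inner_arcs A)\<^sup>*)"
  proof (cases "eW Y a = b")
    case False
    then show ?thesis using ad e_a by blast
  next
    case True
    then obtain p p' where "(p, p') \<in> inner_arcs AW" "(p', a) \<in> (inner_arcs AW)\<^sup>*" "eW Y p \<noteq> p'"
      using n ab unfolding good_def by blast
    then show ?thesis using e_arc_W inner_arcs_W_rtrancl inner_arcs_A by blast
  qed
  then obtain p p' where p: "(p, p') \<in> inner_arcs A" "e Y p \<noteq> p'"
    "(p, p') = (a, d) \<or> (p', a) \<in> (inner_arcs A)\<^sup>*" by blast
  have "\<exists>q q'. (q', q) \<in> inner_arcs A \<and> w Y q \<noteq> q' \<and>
      ((q', q) = (a, d) \<or> (d, q') \<in> (inner_arcs A)\<^sup>*)"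
  proof (cases "wE Y d = c")
    case False
    then show ?thesis using ad dual.e_a by blast
  next
    case True
    then obtain q q' where "(q', q) \<in> inner_arcs AE" "(d, q') \<in> (inner_arcs AE)\<^sup>*" "wE Y q \<noteq> q'"
      using n cd unfolding good_def by (auto simp: rtrancl_converse)
    then show ?thesis using dual.e_arc_W[of q q'] inner_arcs_E_rtrancl inner_arcs_A
      by (metis UnCI converse_iff inner_arcs_converse subsetD)
  qed
  then obtain q q' where q: "(q', q) \<in> inner_arcs A" "w Y q \<noteq> q'"
    "(q', q) = (a, d) \<or> (d, q') \<in> (inner_arcs A)\<^sup>*" by blast
  \<comment> \<open>Both violations at \<open>(a, d)\<close> contradict decency of the two-vertex
    path; otherwise the clause for longer paths applies.\<close>
  have "(p, p') = (a, d) \<and> (q', q) = (a, d) \<or> (p', q') \<in> (inner_arcs A)\<^sup>*"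
    using p(3) q(3) ad by (auto intro: rtrancl_trans converse_rtrancl_into_rtrancl)
  then show False using A p(1,2) q(1,2) unfolding decent_pointers_def by blast
qed

section \<open>Good edges before and after a cut\<close>

lemma good_E_arc:
  assumes eb: "good AW (eW Y) a b" and g: "good AE (eE Y) x y" shows "good A (e Y) x y"
  unfolding good_def
proof (intro conjI allI impI)
  from g have x: "(x, y) \<in> AE" "x \<in> Range AE" "y \<notin> Domain AE" "eE Y x = y"
    by (auto simp: good_def)
  have xc: "x \<noteq> c" using x cd(3) by auto
  have xi: "x \<in> inner_verts AE" using x by (auto simp: inner_verts_def)
  show "(x, y) \<in> A" using x xc unfolding A_eq by auto
  show "x \<in> Range A" using x by (simp add: Range_A)
  show "y \<notin> Domain A" using x(1,3) AE_Field[of x y] by (auto simp: Domain_A Field_def)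
  show "e Y x = y" using e_E[OF xi] x by simp
  fix z z' assume z: "(z, z') \<in> inner_arcs A" and path: "(z', x) \<in> (inner_arcs A)\<^sup>*"
  have xF: "x \<in> Field AE" using x(1) AE_Field by blast
  \<comment> \<open>An arc that leads to \<open>x\<close> either begins a path crossing the cut,
    governed by the goodness of \<open>(a, b)\<close>, or lies in the East half, governed by that of
    \<open>(x, y)\<close>.\<close>
  consider "z \<in> Field AW" | "(z, z') \<in> inner_arcs AE"
    using z inner_arcs_W[of z z'] inside(1) unfolding inner_arcs_A by blast
  then show "e Y z = z'"
  proof cases
    case 1
    then show ?thesis using good_crossing[OF eb z path] xF by blast
  next
    case 2
    then have "(z', x) \<in> (inner_arcs AE)\<^sup>*" using rtrancl_inner_arcs_A[OF path] inner_arcs_E by blast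
    then show ?thesis using g 2 e_arc_E[OF 2] unfolding good_def by blast
  qed
qed

text \<open>Nothing in the East half leads back to \<open>x\<close>, so the cut adds no condition;
  an edge other than \<open>(a, b)\<close> survives it.\<close>

lemma good_W_arc:
  assumes neq: "(x, y) \<noteq> (a, b)" and g: "good AW (eW Y) x y" shows "good A (e Y) x y"
  unfolding good_def
proof (intro conjI allI impI)
  from g have x: "(x, y) \<in> AW" "x \<in> Range AW" "y \<notin> Domain AW" "eW Y x = y"
    by (auto simp: good_def)
  have yb: "y \<noteq> b" using x neq ab(4) by auto
  have xi: "x \<in> inner_verts AW" using x by (auto simp: inner_verts_def)
  show "(x, y) \<in> A" using x neq unfolding A_eq by auto
  show "x \<in> Range A" using x ab(3) by (auto simp: Range_A)
  show "y \<notin> Domain A" using x(1,3) AW_Field[of x y] by (auto simp: Domain_A Field_def)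
  show "e Y x = y" using e_W[OF xi] x yb by simp
  fix z z' assume z: "(z, z') \<in> inner_arcs A" and path: "(z', x) \<in> (inner_arcs A)\<^sup>*"
  have xF: "x \<in> Field AW" using x(1) AW_Field by blast
  then have "z' \<notin> Field AE" using rtrancl_inner_arcs_A[OF path] disj by blast
  then have 2: "(z, z') \<in> inner_arcs AW"
    using z inner_arcs_E[of z z'] inside(4) unfolding inner_arcs_A by blast
  then have "(z', x) \<in> (inner_arcs AW)\<^sup>*" using rtrancl_inner_arcs_A[OF path] inner_arcs_W xF by blast
  then show "e Y z = z'" using g 2 e_arc_W[OF 2] unfolding good_def by blast
qed

lemma good_A_E:
  assumes g: "good A (e Y) x y" and x: "x \<in> Field AE" shows "good AE (eE Y) x y"
  unfolding good_def
proof (intro conjI allI impI)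
  from g have A: "(x, y) \<in> A" "x \<in> Range A" "y \<notin> Domain A" "e Y x = y" by (auto simp: good_def)
  have xy: "(x, y) \<in> AE" using A(1) x AW_Field outside(3) unfolding A_eq by blast
  then show "(x, y) \<in> AE" .
  show xR: "x \<in> Range AE" using A(2) AW_Field x unfolding Range_A by blast
  have "y \<noteq> c" using xy cd(3) by auto
  then show "y \<notin> Domain AE" using A(3) by (auto simp: Domain_A)
  have "x \<in> inner_verts AE" using xy xR by (auto simp: inner_verts_def)
  then show "eE Y x = y" using e_E A(4) by simp
  fix z z' assume z: "(z, z') \<in> inner_arcs AE" and path: "(z', x) \<in> (inner_arcs AE)\<^sup>*"
  have "e Y z = z'"
    using g z path inner_arcs_E_rtrancl unfolding good_def inner_arcs_A by blast
  then show "eE Y z = z'" using e_arc_E[OF z] by simp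
qed

lemma good_A_W:
  assumes g: "good A (e Y) x y" and x: "x \<in> Field AW"
  shows "good AW (eW Y) x y" "(x, y) \<noteq> (a, b)"
proof -
  from g have A: "(x, y) \<in> A" "x \<in> Range A" "y \<notin> Domain A" "e Y x = y" by (auto simp: good_def)
  \<comment> \<open>\<open>d\<close> still begins an arc of \<open>A\<close>, so the good edge
    cannot be \<open>(a, d)\<close>.\<close>
  have "y \<noteq> d" using A(3) cd(2,3) distinct_ends by (auto simp: Domain_A)
  then have xy: "(x, y) \<in> AW" "(x, y) \<noteq> (a, b)" using A(1) x AE_Field unfolding A_eq by blast+
  have xR: "x \<in> Range AW" using A(2) AE_Field x unfolding Range_A by blast
  have xi: "x \<in> inner_verts AW" using xy xR by (auto simp: inner_verts_def)
  show "(x, y) \<noteq> (a, b)" using xy by blast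
  show "good AW (eW Y) x y"
    unfolding good_def
  proof (intro conjI allI impI)
    show "(x, y) \<in> AW" by fact
    show "x \<in> Range AW" by fact
    show "y \<notin> Domain AW" using A(3) by (simp add: Domain_A)
    show "eW Y x = y" using e_W[OF xi] A(4) \<open>y \<noteq> d\<close> by (auto split: if_splits)
    fix z z' assume z: "(z, z') \<in> inner_arcs AW" and path: "(z', x) \<in> (inner_arcs AW)\<^sup>*"
    have "e Y z = z'"
      using g z path inner_arcs_W_rtrancl unfolding good_def inner_arcs_A by blast
    then show "eW Y z = z'" using e_arc_W[OF z] by simp
  qed
qed

text \<open>If \<open>d\<close> leads to \<open>x\<close>, then so do \<open>a\<close> and all that
  leads to \<open>a\<close>; their pointers are therefore forced, that of \<open>a\<close> towards
  \<open>d\<close>, which was \<open>b\<close> before the redirection.\<close>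

lemma good_A_through:
  assumes g: "good A (e Y) x y" and path: "(d, x) \<in> (inner_arcs A)\<^sup>*"
  shows "good AW (eW Y) a b"
  unfolding good_def
proof (intro conjI allI impI)
  have *: "e Y z = z'" if "(z, z') \<in> inner_arcs A" "(z', x) \<in> (inner_arcs A)\<^sup>*" for z z'
    using g that unfolding good_def by blast
  have "e Y a = d" using *[OF _ path] by (simp add: inner_arcs_A)
  then show "eW Y a = b" by (simp add: e_a)
  fix z z' assume z: "(z, z') \<in> inner_arcs AW" and pa: "(z', a) \<in> (inner_arcs AW)\<^sup>*"
  have "(z', a) \<in> (inner_arcs A)\<^sup>*" "(a, d) \<in> inner_arcs A"
    using pa inner_arcs_W_rtrancl inner_arcs_A by auto
  then have "(z', x) \<in> (inner_arcs A)\<^sup>*" using path by (meson rtrancl_into_rtrancl rtrancl_trans)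
  then have "e Y z = z'" using * z by (simp add: inner_arcs_A)
  then show "eW Y z = z'" using e_arc_W[OF z] by simp
qed (use ab in auto)

text \<open>The case distinction is the rule by which \<open>cut_edges\<close> selects YE.\<close>

lemma good_root_E:
  assumes "good AW (eW Y) (fst gW) (snd gW)" "good AE (eE Y) (fst gE) (snd gE)"
  defines "g \<equiv> if (a, b) = gW then gE else gW"
  shows "good A (e Y) (fst g) (snd g)"
  using assms good_E_arc[of Y "fst gE" "snd gE"] good_W_arc[of "fst gW" "snd gW" Y]
  by (auto split: if_splits)

lemma good_root_W:
  assumes "good (AW\<inverse>) (wW Y) (snd fW) (fst fW)" "good (AE\<inverse>) (wE Y) (snd fE) (fst fE)"
  defines "f \<equiv> if (c, d) = fE then fW else fE"
  shows "good (A\<inverse>) (w Y) (snd f) (fst f)"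
  using assms cutting_pointers.good_root_E[OF cutting_pointers_dual, of Y "prod.swap fE" "prod.swap fW"]
  by (cases fE) (auto split: if_splits)

lemma main_edges_unique_E:
  assumes W: "main_edges AW (eW Y) (wW Y) fW gW" and E: "main_edges AE (eE Y) (wE Y) fE gE"
    and cond: "(a, b) = gW \<or> (c, d) = fE" and g: "good A (e Y) x y"
  shows "(x, y) = (if (a, b) = gW then gE else gW)"
proof -
  have "x \<in> Field A" using g by (auto simp: good_def Field_def)
  then consider "x \<in> Field AW" | "x \<in> Field AE"
    unfolding Field_def Domain_A Range_A by blast
  then show ?thesis
  proof cases
    case 1
    then have "(x, y) = gW" "(x, y) \<noteq> (a, b)"
      using good_A_W[OF g 1] W unfolding main_edges_def by blast+
    then show ?thesis by auto
  next
    case 2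
    then have xy: "(x, y) = gE" using good_A_E[OF g 2] E unfolding main_edges_def by blast
    show ?thesis
    proof (cases "(a, b) = gW")
      case False
      \<comment> \<open>Now \<open>d\<close> is where the path from YW to YE of the East half
        starts, so \<open>good_A_through\<close> makes \<open>(a, b)\<close> good and hence equal to
        \<open>gW\<close>.\<close>
      then have "(c, d) = fE" using cond by blast
      moreover have "(snd fE, fst gE) \<in> (inner_arcs AE)\<^sup>*"
        using E unfolding main_edges_def by blast
      ultimately have "(d, x) \<in> (inner_arcs AE)\<^sup>*"
        unfolding xy[symmetric] by (metis fst_conv snd_conv)
      then have "(d, x) \<in> (inner_arcs A)\<^sup>*" using inner_arcs_E_rtrancl by blast
      then have "(a, b) = gW" using good_A_through[OF g] W unfolding main_edges_def by blast
      then show ?thesis using False by blast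
    qed (use xy in simp)
  qed
qed

lemma main_edges_unique_W:
  assumes W: "main_edges AW (eW Y) (wW Y) fW gW" and E: "main_edges AE (eE Y) (wE Y) fE gE"
    and cond: "(a, b) = gW \<or> (c, d) = fE" and g: "good (A\<inverse>) (w Y) t s"
  shows "(s, t) = (if (c, d) = fE then fW else fE)"
proof -
  \<comment> \<open>Reversal exchanges the two distinguished edges and turns each of them
    round.\<close>
  have *: "main_edges (B\<inverse>) w e (prod.swap g) (prod.swap f)" if "main_edges B e w f g"
    for B :: "('a \<times> 'a) set" and e w f g
    using that unfolding main_edges_def by (auto simp: rtrancl_converse prod_eq_iff)
  have "(t, s) = (if (d, c) = prod.swap fE then prod.swap fW else prod.swap fE)"
    by (rule cutting_pointers.main_edges_unique_E[OF cutting_pointers_dual *[OF E] *[OF W] _ g])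
      (use cond in auto)
  then show ?thesis by (cases fE; cases fW) (auto split: if_splits)
qed

lemma main_edges_A:
  assumes W: "main_edges AW (eW Y) (wW Y) fW gW" and E: "main_edges AE (eE Y) (wE Y) fE gE"
    and cond: "(a, b) = gW \<or> (c, d) = fE"
  shows "main_edges A (e Y) (w Y)
    (if (c, d) = fE then fW else fE) (if (a, b) = gW then gE else gW)"
    (is "main_edges _ _ _ ?f ?g")
  unfolding main_edges_def
proof (intro conjI allI impI)
  show "good A (e Y) (fst ?g) (snd ?g)"
    using good_root_E W E unfolding main_edges_def by blast
  show "good (A\<inverse>) (w Y) (snd ?f) (fst ?f)"
    using good_root_W W E unfolding main_edges_def by blast
  \<comment> \<open>If both edges come from one half, its path serves. If YW comes from the West and
    YE from the East, then \<open>gW = (a, b)\<close> and \<open>fE = (c, d)\<close>, and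
    \<open>(a, d)\<close> joins the two paths. The opposite combination is excluded by
    \<open>cond\<close>.\<close>
  have "(snd fW, fst gW) \<in> (inner_arcs A)\<^sup>*" "(snd fE, fst gE) \<in> (inner_arcs A)\<^sup>*"
    using W E inner_arcs_W_rtrancl inner_arcs_E_rtrancl unfolding main_edges_def by blast+
  moreover have "(a, d) \<in> inner_arcs A" by (simp add: inner_arcs_A)
  ultimately show "(snd ?f, fst ?g) \<in> (inner_arcs A)\<^sup>*"
    using cond by (auto intro: rtrancl_trans converse_rtrancl_into_rtrancl)
qed (use main_edges_unique_E[OF W E cond] main_edges_unique_W[OF W E cond] in auto)

lemma kgraph_A:
  assumes W: "kgraph AW eW wW" and E: "kgraph AE eE wE"
    and g: "\<And>Y. good AW (eW Y) a b \<or> good (AE\<inverse>) (wE Y) d c"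
  shows "kgraph A e w"
proof -
  interpret dual: cutting_pointers "AE\<inverse>" "AW\<inverse>" d c b a "A\<inverse>" w wE wW e eE eW
    by (rule cutting_pointers_dual)
  have "finite A" using W E unfolding A_eq kgraph_def by simp
  moreover have "inner_verts A \<noteq> {}" using a_inner inner_verts_A by blast
  ultimately show ?thesis
    using W E g unfolding kgraph_def
    by (simp add: tree_arcs_A out_functional_A dual.out_functional_A pointers_A dual.pointers_A
        separating_A dual.separating_A decent_A)
qed

lemma kgraph_W:
  assumes A: "kgraph A e w" shows "kgraph AW eW wW"
proof -
  interpret dual: cutting_pointers "AE\<inverse>" "AW\<inverse>" d c b a "A\<inverse>" w wE wW e eE eW
    by (rule cutting_pointers_dual)
  have "AW \<subseteq> insert (a, b) A" by (auto simp: A_eq)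
  then have "finite AW" using A finite_subset unfolding kgraph_def by blast
  moreover have "inner_verts AW \<noteq> {}" using a_inner by blast
  ultimately show ?thesis
    using A unfolding kgraph_def
    by (simp add: tree_arcs_W out_functional_A dual.out_functional_A ptr_e ptr_w
        separating_W dual.separating_E decent_W)
qed

lemma kgraph_E: "kgraph A e w \<Longrightarrow> kgraph AE eE wE"
  using kgraph_converse cutting_pointers.kgraph_W[OF cutting_pointers_dual] converse_converse
  by metis

end

section \<open>Constructions\<close>

lemma (in cutting) Field_A: "Field A = (Field AW \<union> Field AE) - {b, c}"
proof -
  have "b \<notin> Domain AE \<union> Range AE" "c \<notin> Domain AW \<union> Range AW"
    using outside(2,4) by (auto simp: Field_def)
  then show ?thesis using ab(3) cd(3) unfolding Field_def Domain_A Range_A by blast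
qed

text \<open>The halves are the components of \<open>a\<close> and \<open>d\<close> after deletion of
  the bridge \<open>(a, d)\<close>, each completed by a new leaf at which the pointers along the
  deleted arc are redirected.\<close>

lemma kgraph_cuttable:
  assumes k: "kgraph A e w" and ad: "(a, d) \<in> inner_arcs A"
    and b: "b \<notin> Field A" and c: "c \<notin> Field A" and bc: "b \<noteq> c"
  obtains AW AE eW wE where "cutting_pointers AW AE a b c d A e eW e w w wE"
proof -
  have t: "tree_arcs A" using k by (simp add: kgraph_def)
  have adA: "(a, d) \<in> A" using ad inner_arcs_subset by blast
  define B where "B = A - {(a, d)}"
  define VW where "VW = {x. (a, x) \<in> (sym_arcs B)\<^sup>*}"
  define VE where "VE = {x. (d, x) \<in> (sym_arcs B)\<^sup>*}"
  \<comment> \<open>Restricting only the beginnings suffices: arcs of \<open>B\<close> do not leave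
    a component.\<close>
  define AW where "AW = insert (a, b) (B \<inter> VW \<times> UNIV)"
  define AE where "AE = insert (c, d) (B \<inter> VE \<times> UNIV)"
  define eW where "eW Y z = (if e Y z = d then b else e Y z)" for Y z
  define wE where "wE Y z = (if w Y z = a then c else w Y z)" for Y z
  have step: "(r, p) \<in> (sym_arcs B)\<^sup>* \<longleftrightarrow> (r, q) \<in> (sym_arcs B)\<^sup>*" if "(p, q) \<in> B" for r p q
  proof -
    have "(p, q) \<in> sym_arcs B" "(q, p) \<in> sym_arcs B" using that by (auto simp: sym_arcs_def)
    then show ?thesis by (meson rtrancl_into_rtrancl)
  qed
  then have VW_step: "p \<in> VW \<longleftrightarrow> q \<in> VW" and VE_step: "p \<in> VE \<longleftrightarrow> q \<in> VE" if "(p, q) \<in> B" for p q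
    using that unfolding VW_def VE_def by blast+
  have aVW: "a \<in> VW" and dVE: "d \<in> VE" by (simp_all add: VW_def VE_def)
  have disjV: "VW \<inter> VE = {}"
  proof -
    have "(a, d) \<notin> (sym_arcs B)\<^sup>*" using t adA unfolding tree_arcs_def B_def by blast
    then show ?thesis unfolding VW_def VE_def
      by (auto dest: rtrancl_sym_arcs_sym intro: rtrancl_trans)
  qed
  have cover: "x \<in> VW \<union> VE" if "x \<in> Field A" for x
  proof -
    have "(a, x) \<in> (sym_arcs A)\<^sup>*"
      using t that adA unfolding tree_arcs_def by (auto simp: Field_def)
    then show ?thesis
    proof (rule rtrancl_sym_arcs_closed)
      show "a \<in> VW \<union> VE" using aVW by simp
      show "p \<in> VW \<union> VE \<longleftrightarrow> q \<in> VW \<union> VE" if "(p, q) \<in> A" for p q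
        using that VW_step[of p q] VE_step[of p q] aVW dVE by (auto simp: B_def)
    qed
  qed
  have subF: "x \<in> Field A" if "x \<in> VW \<union> VE" for x
  proof -
    have "(a, x) \<in> (sym_arcs B)\<^sup>* \<or> (d, x) \<in> (sym_arcs B)\<^sup>*" using that by (auto simp: VW_def VE_def)
    moreover have "a \<in> Field A" "d \<in> Field A" using adA by (auto simp: Field_def)
    moreover have "p \<in> Field A \<longleftrightarrow> q \<in> Field A" if "(p, q) \<in> B" for p q
      using that by (auto simp: B_def Field_def)
    ultimately show ?thesis using rtrancl_sym_arcs_closed by metis
  qed
  have fresh: "(x, b) \<notin> A" "(b, x) \<notin> A" "(x, c) \<notin> A" "(c, x) \<notin> A" for x
    using b c by (auto simp: Field_def)
  have ndV: "b \<notin> VW \<union> VE" "c \<notin> VW \<union> VE" using b c subF by blast+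
  have FW: "Field AW \<subseteq> insert b VW" and FE: "Field AE \<subseteq> insert c VE"
    using aVW dVE VW_step VE_step unfolding AW_def AE_def Field_def by auto
  have cut: "cutting AW AE a b c d A"
  proof unfold_locales
    show "Field AW \<inter> Field AE = {}" using FW FE disjV ndV bc by blast
    show "(a, b) \<in> AW" "(c, d) \<in> AE" by (simp_all add: AW_def AE_def)
    obtain p where p: "(p, a) \<in> A" using ad by (auto simp: inner_arcs_iff)
    have "(p, a) \<in> B" using p tree_arcs_irrefl[OF t] adA by (auto simp: B_def)
    then have "(p, a) \<in> AW" using VW_step aVW by (auto simp: AW_def)
    then show "a \<in> Range AW" by blast
    obtain q where q: "(d, q) \<in> A" using ad by (auto simp: inner_arcs_iff)
    have "(d, q) \<in> B" using q tree_arcs_irrefl[OF t] adA by (auto simp: B_def)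
    then have "(d, q) \<in> AE" using dVE by (auto simp: AE_def)
    then show "d \<in> Domain AE" by blast
    show "b \<notin> Domain AW" using aVW ndV by (auto simp: AW_def)
    show "c \<notin> Range AE" using dVE ndV fresh by (auto simp: AE_def B_def)
    show "(x, b) \<in> AW \<longleftrightarrow> x = a" for x using fresh by (auto simp: AW_def B_def)
    show "(c, x) \<in> AE \<longleftrightarrow> x = d" for x using fresh by (auto simp: AE_def B_def)
    show "A = AW - {(a, b)} \<union> (AE - {(c, d)}) \<union> {(a, d)}"
    proof -
      have "A = B \<union> {(a, d)}" using adA by (auto simp: B_def)
      also have "B = (B \<inter> VW \<times> UNIV) \<union> (B \<inter> VE \<times> UNIV)"
        using cover by (auto simp: B_def Field_def)
      also have "B \<inter> VW \<times> UNIV = AW - {(a, b)}"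
        using fresh by (auto simp: AW_def B_def)
      also have "B \<inter> VE \<times> UNIV = AE - {(c, d)}"
        using fresh by (auto simp: AE_def B_def)
      finally show ?thesis .
    qed
  qed
  then interpret cutting AW AE a b c d A .
  \<comment> \<open>Hence a pointer to be redirected can only be one of \<open>a\<close> to
    \<open>d\<close> or one of \<open>d\<close> to \<open>a\<close>.\<close>
  have cross: "z = a \<and> z' = d" if "(z, z') \<in> A" "z \<in> VW" "z' \<in> VE" for z z'
    using that VW_step[of z z'] disjV by (auto simp: B_def)
  have iW: "z \<in> VW \<and> (z, e Y z) \<in> A \<and> (w Y z, z) \<in> A" if "z \<in> inner_verts AW" for z Y
  proof -
    have "z \<in> inner_verts A" using that by (simp add: inner_verts_A)
    moreover have "z \<in> VW" using that FW ab(3) unfolding inner_verts_def Field_def by blast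
    ultimately show ?thesis using k unfolding kgraph_def pointers_def by auto
  qed
  have iE: "z \<in> VE \<and> (z, e Y z) \<in> A \<and> (w Y z, z) \<in> A" if "z \<in> inner_verts AE" for z Y
  proof -
    have "z \<in> inner_verts A" using that by (simp add: inner_verts_A)
    moreover have "z \<in> VE" using that FE cd(3) unfolding inner_verts_def Field_def by blast
    ultimately show ?thesis using k unfolding kgraph_def pointers_def by auto
  qed
  have "cutting_pointers AW AE a b c d A e eW e w w wE"
  proof unfold_locales
    show "pointers AW eW" unfolding pointers_def
    proof (intro allI ballI)
      fix Y z assume z: "z \<in> inner_verts AW"
      show "(z, eW Y z) \<in> AW"
      proof (cases "e Y z = d")
        case True
        then have "z = a" using iW[OF z, of Y] cross dVE by metis
        then show ?thesis using True by (simp add: eW_def ab)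
      next
        case False
        then show ?thesis using iW[OF z, of Y] by (simp add: eW_def AW_def B_def)
      qed
    qed
    show "pointers AE e" unfolding pointers_def
    proof (intro allI ballI)
      fix Y z assume z: "z \<in> inner_verts AE"
      have "z \<noteq> a" using iE[OF z] aVW disjV by blast
      then show "(z, e Y z) \<in> AE" using iE[OF z, of Y] by (simp add: AE_def B_def)
    qed
    show "pointers (AE\<inverse>) wE" unfolding pointers_def
    proof (intro allI ballI)
      fix Y z assume "z \<in> inner_verts (AE\<inverse>)"
      then have z: "z \<in> inner_verts AE" by simp
      show "(z, wE Y z) \<in> AE\<inverse>"
      proof (cases "w Y z = a")
        case True
        then have "z = d" using iE[OF z, of Y] cross aVW by metis
        then show ?thesis using True by (simp add: wE_def cd)
      next
        case False
        then have "(w Y z, z) \<in> B" using iE[OF z, of Y] by (simp add: B_def)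
        then show ?thesis using False iE[OF z] VE_step by (simp add: wE_def AE_def)
      qed
    qed
    show "pointers (AW\<inverse>) w" unfolding pointers_def
    proof (intro allI ballI)
      fix Y z assume "z \<in> inner_verts (AW\<inverse>)"
      then have z: "z \<in> inner_verts AW" by simp
      have "z \<noteq> d" using iW[OF z] dVE disjV by blast
      then have "(w Y z, z) \<in> B" using iW[OF z, of Y] by (simp add: B_def)
      then show "(z, w Y z) \<in> AW\<inverse>" using iW[OF z] VW_step by (simp add: AW_def)
    qed
    show "e Y z = (if eW Y z = b then d else eW Y z)" if "z \<in> inner_verts AW" for Y z
      using iW[OF that, of Y] fresh(1) by (auto simp: eW_def)
    show "w Y z = (if wE Y z = c then a else wE Y z)" if "z \<in> inner_verts AE" for Y z
      using iE[OF that, of Y] fresh(4) by (auto simp: wE_def)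
  qed simp_all
  then show thesis by (rule that)
qed

lemma kgraph_oriented:
  assumes "kgraph A e w" shows "oriented_graph \<lparr>pverts = Field A, parcs = A\<rparr>"
proof -
  have t: "tree_arcs A" and f: "finite A" and i: "inner_verts A \<noteq> {}"
    using assms by (auto simp: kgraph_def)
  have "pair_digraph \<lparr>pverts = Field A, parcs = A\<rparr>"
    by unfold_locales (use f tree_arcs_irrefl[OF t] in \<open>auto simp: Field_def finite_Domain finite_Range\<close>)
  moreover have "Field A \<noteq> {}" using i by (auto simp: inner_verts_def Field_def)
  ultimately show ?thesis
    unfolding oriented_graph_def finite_digraph_def using tree_arcs_asym[OF t] by simp
qed

text \<open>Without inner arcs all neighbours of \<open>b\<close> are W- or E-vertices, and
  functionality allows them no further arc. So \<open>b\<close> and its neighbours form a component,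
  which by connectedness is everything.\<close>

lemma kgraph_star:
  assumes k: "kgraph A e w" and no: "inner_arcs A = {}" and b: "b \<in> inner_verts A"
    and pq: "(p, q) \<in> A"
  shows "p = b \<or> q = b"
proof -
  have out: "q = b" if "(p, q) \<in> A" "(p, b) \<in> A" for p q
  proof -
    have "p \<notin> Range A" using no b that(2) inner_arcs_iff[of p b A] unfolding inner_verts_def by blast
    then show ?thesis using k that unfolding kgraph_def out_functional_def by blast
  qed
  have inn: "p = b" if "(p, q) \<in> A" "(b, q) \<in> A" for p q
  proof -
    have "q \<notin> Domain A" using no b that(2) inner_arcs_iff[of b q A] unfolding inner_verts_def by blast
    then show ?thesis using k that unfolding kgraph_def out_functional_def by auto
  qed
  have nE: "(b, p) \<notin> A" if "(p, q) \<in> A" for p q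
    using no b that inner_arcs_iff[of b p A] unfolding inner_verts_def by blast
  have nW: "(q, b) \<notin> A" if "(p, q) \<in> A" for p q
    using no b that inner_arcs_iff[of q b A] unfolding inner_verts_def by blast
  define X where "X = {x. x = b \<or> (x, b) \<in> A \<or> (b, x) \<in> A}"
  have "(b, p) \<in> (sym_arcs A)\<^sup>*"
    using k b pq unfolding kgraph_def tree_arcs_def inner_verts_def Field_def by blast
  then have "p \<in> X"
  proof (rule rtrancl_sym_arcs_closed)
    show "r \<in> X \<longleftrightarrow> s \<in> X" if "(r, s) \<in> A" for r s
      using out[OF that] inn[OF that] nE[OF that] nW[OF that] that unfolding X_def by auto
  qed (simp add: X_def)
  then show ?thesis using out[OF pq] nE[OF pq] unfolding X_def by blast
qed

lemma kgraph_basic: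
  assumes k: "kgraph A e w" and no: "inner_arcs A = {}" and b: "b \<in> inner_verts A"
    and d: "\<And>Y. d Y West = (w Y b, b)" "\<And>Y. d Y East = (b, e Y b)"
  shows "basic_K_graph \<lparr>pverts = Field A, parcs = A\<rparr> d"
    and "main_edges A (e Y) (w Y) (d Y West) (d Y East)"
proof -
  have t: "tree_arcs A" and f: "finite A" using k by (auto simp: kgraph_def)
  define P where "P = {p. (p, b) \<in> A}"
  define C where "C = {q. (b, q) \<in> A}"
  have star: "A = P \<times> {b} \<union> {b} \<times> C"
    using kgraph_star[OF k no b] by (auto simp: P_def C_def)
  have ptr: "w Y b \<in> P" "e Y b \<in> C" for Y
    using k b unfolding kgraph_def pointers_def P_def C_def by auto
  have bPC: "b \<notin> P" "b \<notin> C" using tree_arcs_irrefl[OF t] by (auto simp: P_def C_def)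
  have PC: "P \<inter> C = {}" using tree_arcs_asym[OF t] by (auto simp: P_def C_def)
  have "P \<subseteq> Domain A" "C \<subseteq> Range A" by (auto simp: P_def C_def)
  then have "finite P" "finite C" using f finite_Domain finite_Range finite_subset by metis+
  then obtain as cs where l: "set as = P" "distinct as" "set cs = C" "distinct cs"
    using finite_distinct_list by metis
  have two: "a1 \<noteq> a2" if "2 \<le> length xs" "distinct xs" "\<And>p q. p \<in> set xs \<Longrightarrow> q \<in> set xs \<Longrightarrow> p \<noteq> q \<Longrightarrow> a1 \<noteq> a2"
    for xs :: "'a list" and a1 a2 :: 'a
  proof -
    have "card (set xs) \<ge> 2" using that distinct_card by metis
    then obtain p q where "p \<in> set xs" "q \<in> set xs" "p \<noteq> q"
      using card_le_Suc0_iff_eq[of "set xs"] by fastforce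
    then show ?thesis using that(3) by blast
  qed
  have W: "length as \<ge> 2 \<longrightarrow> d North West \<noteq> d South West"
    using two[of as "w North b" "w South b"] l k b unfolding kgraph_def separating_def d
    by (auto simp: P_def)
  have E: "length cs \<ge> 2 \<longrightarrow> d North East \<noteq> d South East"
    using two[of cs "e North b" "e South b"] l k b unfolding kgraph_def separating_def d
    by (auto simp: C_def)
  have "W_edge \<lparr>pverts = Field A, parcs = A\<rparr> (d Y West) \<and> E_edge \<lparr>pverts = Field A, parcs = A\<rparr> (d Y East)" for Y
    using ptr[of Y] bPC PC unfolding W_edge_def E_edge_def W_vertex_def E_vertex_def d star
    by (auto simp: Field_def)
  moreover have "Field A = set (as @ b # cs)"
    using ptr unfolding star by (auto simp: Field_def l)
  moreover have "as \<noteq> []" "cs \<noteq> []" using ptr l by auto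
  moreover have "A = set as \<times> {b} \<union> {b} \<times> set cs" using star l by simp
  moreover have "distinct (as @ b # cs)" using l bPC PC by auto
  ultimately have "\<exists>as b cs. as \<noteq> [] \<and> cs \<noteq> [] \<and> distinct (as @ b # cs) \<and>
      Field A = set (as @ b # cs) \<and> A = set as \<times> {b} \<union> {b} \<times> set cs \<and>
      (\<forall>Y. W_edge \<lparr>pverts = Field A, parcs = A\<rparr> (d Y West) \<and>
           E_edge \<lparr>pverts = Field A, parcs = A\<rparr> (d Y East)) \<and>
      (length as \<ge> 2 \<longrightarrow> d North West \<noteq> d South West) \<and>
      (length cs \<ge> 2 \<longrightarrow> d North East \<noteq> d South East)"
    using W E by metis
  with kgraph_oriented[OF k] show "basic_K_graph \<lparr>pverts = Field A, parcs = A\<rparr> d"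
    unfolding basic_K_graph_def pair_pre_digraph.select_convs by (rule conjI)
  \<comment> \<open>With no inner arcs, goodness only concerns the pointer of the centre, which also
    makes the good edges unique.\<close>
  have ge: "good A (e Y) b (e Y b)" and gw: "good (A\<inverse>) (w Y) b (w Y b)"
    using ptr[of Y] bPC PC no unfolding good_def by (auto simp: star)
  have ue: "(x, y) = (b, e Y b)" if "good A (e Y) x y" for x y
  proof -
    have "x = b" using that bPC PC unfolding good_def by (auto simp: star)
    then show ?thesis using that by (simp add: good_def)
  qed
  have uw: "(y, x) = (w Y b, b)" if "good (A\<inverse>) (w Y) x y" for x y
  proof -
    have "x = b" using that bPC PC unfolding good_def by (auto simp: star)
    then show ?thesis using that by (simp add: good_def)
  qed
  show "main_edges A (e Y) (w Y) (d Y West) (d Y East)"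
    unfolding main_edges_def d fst_conv snd_conv using ge gw ue uw by blast
qed

text \<open>Constant functions can serve as pointers because the centre is the only inner
  vertex.\<close>

lemma basic_kgraph:
  assumes B: "basic_K_graph B d"
  defines "e \<equiv> \<lambda>Y _. snd (d Y East)" and "w \<equiv> \<lambda>Y _. fst (d Y West)"
  shows "pverts B = Field (parcs B)" and "kgraph (parcs B) e w"
    and "good (parcs B) (e Y) (fst (d Y East)) (snd (d Y East))"
    and "good ((parcs B)\<inverse>) (w Y) (snd (d Y West)) (fst (d Y West))"
proof -
  obtain as b cs where s: "as \<noteq> []" "cs \<noteq> []" "distinct (as @ b # cs)"
      "pverts B = set (as @ b # cs)" "parcs B = set as \<times> {b} \<union> {b} \<times> set cs"
      "\<And>Y. W_edge B (d Y West) \<and> E_edge B (d Y East)"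
      "length as \<ge> 2 \<longrightarrow> d North West \<noteq> d South West"
      "length cs \<ge> 2 \<longrightarrow> d North East \<noteq> d South East"
    using B unfolding basic_K_graph_def by blast
  define A where "A = parcs B"
  define P where "P = set as"
  define C where "C = set cs"
  have A: "A = P \<times> {b} \<union> {b} \<times> C" using s by (simp add: A_def P_def C_def)
  have ne: "P \<noteq> {}" "C \<noteq> {}" "finite P" "finite C" and dis: "b \<notin> P" "b \<notin> C" "P \<inter> C = {}"
    using s by (auto simp: P_def C_def)
  obtain p0 q0 where "p0 \<in> P" "q0 \<in> C" using ne by blast
  then have DR: "Domain A = insert b P" "Range A = insert b C" unfolding A by blast+
  then show F: "pverts B = Field (parcs B)"
    using s(4) by (simp add: Field_def A_def P_def C_def)
  have dW: "\<exists>p\<in>P. d Y West = (p, b)" and dE: "\<exists>q\<in>C. d Y East = (b, q)" for Y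
    using s(6)[of Y] ne dis F unfolding W_edge_def E_edge_def W_vertex_def E_vertex_def A_def[symmetric] A
    by (cases "d Y West"; cases "d Y East"; fastforce)+
  have inner: "inner_verts A = {b}" using ne dis by (auto simp: inner_verts_def A)
  have no: "inner_arcs A = {}" unfolding inner_arcs_def inner using dis by (auto simp: A)
  have tree: "tree_arcs A"
    unfolding tree_arcs_def
  proof (intro conjI ballI allI impI)
    have *: "(u, b) \<in> (sym_arcs A)\<^sup>*" if "u \<in> Field A" for u
      using that by (auto simp: A Field_def sym_arcs_def)
    show "(u, v) \<in> (sym_arcs A)\<^sup>*" if "u \<in> Field A" "v \<in> Field A" for u v
      using *[OF that(1)] *[OF that(2)] by (meson rtrancl_trans rtrancl_sym_arcs_sym)
  next
    fix u v assume uv: "(u, v) \<in> A"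
    show "(u, v) \<notin> (sym_arcs (A - {(u, v)}))\<^sup>*"
    proof
      assume r: "(u, v) \<in> (sym_arcs (A - {(u, v)}))\<^sup>*"
      \<comment> \<open>Deleting an arc of a star isolates its leaf, which is \<open>u\<close> if
        the arc enters the centre and \<open>v\<close> if it leaves it.\<close>
      define X where "X = (if v = b then {u} else - {v})"
      have "v \<in> X" using r
        by (rule rtrancl_sym_arcs_closed) (use uv dis in \<open>auto simp: X_def A split: if_splits\<close>)
      then show False using uv dis by (auto simp: X_def A split: if_splits)
    qed
  qed
  have two: "length xs \<ge> 2" if "p \<in> set xs" "q \<in> set xs" "p \<noteq> q" for p q and xs :: "'a list"
    using that by (cases xs; cases "tl xs") auto
  have sepE: "separating A e"
    using s(8) two[of _ cs] dE[of North] dE[of South] dis unfolding separating_def inner e_def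
    by (auto simp: A C_def)
  have sepW: "separating (A\<inverse>) w"
    using s(7) two[of _ as] dW[of North] dW[of South] dis inner
    unfolding separating_def w_def inner_verts_converse
    by (auto simp: A P_def)
  have "(b, snd (d Y East)) \<in> A" "(fst (d Y West), b) \<in> A" for Y
    using dE[of Y] dW[of Y] by (auto simp: A)
  then have pE: "pointers A e" and pW: "pointers (A\<inverse>) w"
    unfolding pointers_def inner_verts_converse inner e_def w_def by simp_all
  have fun_out: "out_functional A" "out_functional (A\<inverse>)"
    using dis ne unfolding out_functional_def A by auto
  have "finite A" using ne by (simp add: A)
  then have "kgraph A e w"
    unfolding kgraph_def using tree inner sepE sepW pE pW fun_out no
    by (simp add: decent_pointers_def)
  then show "kgraph (parcs B) e w" by (simp add: A_def)
  obtain q where "q \<in> C" "d Y East = (b, q)" using dE by blast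
  then show "good (parcs B) (e Y) (fst (d Y East)) (snd (d Y East))"
    using dis no DR unfolding good_def A_def[symmetric] e_def by (simp add: A) blast
  obtain p where "p \<in> P" "d Y West = (p, b)" using dW by blast
  then show "good ((parcs B)\<inverse>) (w Y) (snd (d Y West)) (fst (d Y West))"
    using dis no DR unfolding good_def A_def[symmetric] w_def by (simp add: A) blast
qed

section \<open>The two inductions\<close>

lemma construction_kgraph:
  assumes "construction G"
  shows "\<exists>A e w. root_graph G = \<lparr>pverts = Field A, parcs = A\<rparr> \<and> kgraph A e w \<and>
    (\<forall>Y. good A (e Y) (fst (root_edge G Y East)) (snd (root_edge G Y East)) \<and>
         good (A\<inverse>) (w Y) (snd (root_edge G Y West)) (fst (root_edge G Y West)))"
  using assms
proof induction
  case (basic B d)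
  show ?case
  proof (intro exI conjI allI)
    show "root_graph (Node Leaf (B, d) Leaf) = \<lparr>pverts = Field (parcs B), parcs = parcs B\<rparr>"
      using basic_kgraph(1)[OF basic] by (simp add: root_graph_def)
    show "kgraph (parcs B) (\<lambda>Y _. snd (d Y East)) (\<lambda>Y _. fst (d Y West))"
      by (rule basic_kgraph(2)[OF basic])
  qed (use basic_kgraph(3,4)[OF basic] in \<open>simp_all add: root_edge_def\<close>)
next
  case (cut GW GE fe fw)
  obtain AW eW wW where W: "root_graph GW = \<lparr>pverts = Field AW, parcs = AW\<rparr>" "kgraph AW eW wW"
    "\<And>Y. good AW (eW Y) (fst (root_edge GW Y East)) (snd (root_edge GW Y East))"
    "\<And>Y. good (AW\<inverse>) (wW Y) (snd (root_edge GW Y West)) (fst (root_edge GW Y West))"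
    using cut.IH(1) by blast
  obtain AE eE wE where E: "root_graph GE = \<lparr>pverts = Field AE, parcs = AE\<rparr>" "kgraph AE eE wE"
    "\<And>Y. good AE (eE Y) (fst (root_edge GE Y East)) (snd (root_edge GE Y East))"
    "\<And>Y. good (AE\<inverse>) (wE Y) (snd (root_edge GE Y West)) (fst (root_edge GE Y West))"
    using cut.IH(2) by blast
  obtain a b where fe: "fe = (a, b)" by (cases fe)
  obtain c d where fw: "fw = (c, d)" by (cases fw)
  define A where "A = (AW - {(a, b)}) \<union> (AE - {(c, d)}) \<union> {(a, d)}"
  define e where "e Y z = (if z \<in> Field AE then eE Y z else if eW Y z = b then d else eW Y z)" for Y z
  define w where "w Y z = (if z \<in> Field AW then wW Y z else if wE Y z = c then a else wE Y z)" for Y z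
  have ab: "(a, b) \<in> AW" "b \<notin> Domain AW" "\<And>x. (x, b) \<in> AW \<Longrightarrow> x = a"
    using cut.hyps(4) unfolding W(1) fe functional_E_edge_def E_edge_def E_vertex_def by auto
  have cd: "(c, d) \<in> AE" "c \<notin> Range AE" "\<And>x. (c, x) \<in> AE \<Longrightarrow> x = d"
    using cut.hyps(5) unfolding E(1) fw functional_W_edge_def W_edge_def W_vertex_def by auto
  have disj: "Field AW \<inter> Field AE = {}" using cut.hyps(3) by (simp add: W E)
  have "cutting AW AE a b c d A"
  proof
    \<comment> \<open>A cut only asks for functional edges; that \<open>a\<close> and
      \<open>d\<close> are inner comes from the halves being K-graphs.\<close>
    show "a \<in> Range AW" by (rule kgraph_domain_inner[OF W(2) ab(1,2)])
    have "d \<in> Range (AE\<inverse>)"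
      by (rule kgraph_domain_inner[OF kgraph_converse[OF E(2)], of d c]) (use cd(1,2) in auto)
    then show "d \<in> Domain AE" by simp
    show "(x, b) \<in> AW \<longleftrightarrow> x = a" for x using ab(1,3) by metis
    show "(c, x) \<in> AE \<longleftrightarrow> x = d" for x using cd(1,3) by metis
  qed (fact disj ab cd A_def)+
  moreover have "cutting_pointers_axioms AW AE a b c d e eW eE w wW wE"
  proof
    show "e Y z = (if eW Y z = b then d else eW Y z)" if "z \<in> inner_verts AW" for Y z
      using that disj by (auto simp: e_def inner_verts_def Field_def)
    show "e Y z = eE Y z" if "z \<in> inner_verts AE" for Y z
      using that by (auto simp: e_def inner_verts_def Field_def)
    show "w Y z = (if wE Y z = c then a else wE Y z)" if "z \<in> inner_verts AE" for Y z
      using that disj by (auto simp: w_def inner_verts_def Field_def)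
    show "w Y z = wW Y z" if "z \<in> inner_verts AW" for Y z
      using that by (auto simp: w_def inner_verts_def Field_def)
  qed (use W(2) E(2) in \<open>simp_all add: kgraph_def\<close>)
  ultimately interpret cutting_pointers AW AE a b c d A e eW eE w wW wE
    by (rule cutting_pointers.intro)
  \<comment> \<open>The reason why goodness of the root edges belongs to the induction: it turns the
    side condition into the hypothesis of \<open>kgraph_A\<close>.\<close>
  have "good AW (eW Y) a b \<or> good (AE\<inverse>) (wE Y) d c" for Y
    using cut.hyps(6)[of Y] W(3)[of Y] E(4)[of Y] unfolding fe fw by (metis fst_conv snd_conv)
  then have "kgraph A e w" by (rule kgraph_A[OF W(2) E(2)])
  moreover have "Defs.cut (root_graph GW) fe fw (root_graph GE) = \<lparr>pverts = Field A, parcs = A\<rparr>"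
    unfolding Defs.cut_def W(1) E(1) fe fw Field_A by (simp add: A_eq insert_commute)
  ultimately show ?case
    using good_root_E[OF W(3) E(3)] good_root_W[OF W(4) E(4)]
    unfolding root_graph_def root_edge_def cut_edges_def fe fw
    by (intro exI[of _ A] exI[of _ e] exI[of _ w]) (simp)
qed

text \<open>The distinguished edges of a construction cannot be chosen freely, whereas decency only
  yields a good cut edge; \<open>main_edges\<close> in the conclusion identifies the two.\<close>

lemma kgraph_construction:
  fixes A :: "('a \<times> 'a) set"
  assumes inf: "infinite (UNIV :: 'a set)" and "kgraph A e w"
  shows "\<exists>G. construction G \<and> root_graph G = \<lparr>pverts = Field A, parcs = A\<rparr> \<and>
    (\<forall>Y. main_edges A (e Y) (w Y) (root_edge G Y West) (root_edge G Y East))"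
  using assms(2)
proof (induction "card (inner_arcs A)" arbitrary: A e w rule: less_induct)
  case less
  note k = less.prems
  have fin: "finite (Field B)" "finite (inner_arcs B)" if "kgraph B e' w'"
    for B :: "('a \<times> 'a) set" and e' w'
    using that finite_subset[OF inner_arcs_subset, of B] by (auto simp: kgraph_def finite_Field)
  show ?case
  proof (cases "inner_arcs A = {}")
    case True
    obtain b where b: "b \<in> inner_verts A" using k by (auto simp: kgraph_def)
    define d where "d Y X = (case X of West \<Rightarrow> (w Y b, b) | East \<Rightarrow> (b, e Y b))" for Y X
    have d: "d Y West = (w Y b, b)" "d Y East = (b, e Y b)" for Y by (simp_all add: d_def)
    note bas = kgraph_basic[of A e w b d, OF k True b d]
    show ?thesis
      by (rule exI[of _ "Node Leaf (\<lparr>pverts = Field A, parcs = A\<rparr>, d) Leaf"])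
        (use bas in \<open>simp add: construction.basic root_graph_def root_edge_def\<close>)
  next
    case False
    then obtain a d where ad: "(a, d) \<in> inner_arcs A" by auto
    \<comment> \<open>The two vertices omitted by the cut have to be new, hence the infinite
      type.\<close>
    obtain b where b: "b \<notin> Field A" using ex_new_if_finite[OF inf fin(1)[OF k]] by blast
    obtain c where c: "c \<notin> insert b (Field A)"
      using ex_new_if_finite[OF inf, of "insert b (Field A)"] fin(1)[OF k] by blast
    obtain AW AE eW wE where "cutting_pointers AW AE a b c d A e eW e w w wE"
      using kgraph_cuttable[OF k ad b, of c] c by blast
    then interpret cutting_pointers AW AE a b c d A e eW e w w wE .
    \<comment> \<open>Both inclusions are proper because \<open>(a, d)\<close> lies in neither
      half.\<close>
    have sub: "inner_arcs AW \<subset> inner_arcs A" "inner_arcs AE \<subset> inner_arcs A"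
      using inner_arcs_W[of a d] inner_arcs_E[of a d] inside(4) unfolding inner_arcs_A by blast+
    have kW: "kgraph AW eW w" and kE: "kgraph AE e wE" using kgraph_W[OF k] kgraph_E[OF k] by auto
    obtain GW where GW: "construction GW" "root_graph GW = \<lparr>pverts = Field AW, parcs = AW\<rparr>"
      "\<And>Y. main_edges AW (eW Y) (w Y) (root_edge GW Y West) (root_edge GW Y East)"
      using less.hyps[OF psubset_card_mono[OF fin(2)[OF k] sub(1)] kW] by blast
    obtain GE where GE: "construction GE" "root_graph GE = \<lparr>pverts = Field AE, parcs = AE\<rparr>"
      "\<And>Y. main_edges AE (e Y) (wE Y) (root_edge GE Y West) (root_edge GE Y East)"
      using less.hyps[OF psubset_card_mono[OF fin(2)[OF k] sub(2)] kE] by blast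
    have cond: "(a, b) = root_edge GW Y East \<or> (c, d) = root_edge GE Y West" for Y
    proof -
      have "good AW (eW Y) a b \<or> good (AE\<inverse>) (wE Y) d c"
        using k by (intro decent_good) (simp add: kgraph_def)
      then show ?thesis using GW(3)[of Y] GE(3)[of Y] unfolding main_edges_def by blast
    qed
    let ?G = "Node GW (Defs.cut (root_graph GW) (a, b) (c, d) (root_graph GE),
      cut_edges GW (a, b) (c, d) GE) GE"
    have "construction ?G"
    proof (rule construction.cut)
      show "functional_E_edge (root_graph GW) (a, b)"
        using ab(1,3,4) by (auto simp: functional_E_edge_def E_edge_def E_vertex_def GW(2))
      show "functional_W_edge (root_graph GE) (c, d)"
        using cd(1,3,4) by (auto simp: functional_W_edge_def W_edge_def W_vertex_def GE(2))
    qed (use GW GE disj cond in auto)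
    moreover have "root_graph ?G = \<lparr>pverts = Field A, parcs = A\<rparr>"
      unfolding root_graph_def
      unfolding Defs.cut_def GW(2)[unfolded root_graph_def] GE(2)[unfolded root_graph_def] Field_A
      by (simp add: A_eq insert_commute)
    moreover have "main_edges A (e Y) (w Y) (root_edge ?G Y West) (root_edge ?G Y East)" for Y
      using main_edges_A[OF GW(3) GE(3) cond] by (simp add: root_edge_def cut_edges_def)
    ultimately show ?thesis by blast
  qed
qed

section \<open>Local K-graphs as relations\<close>

lemma successively_rtrancl:
  assumes "successively (\<lambda>p q. (p, q) \<in> R) xs" and "x \<in> set xs"
  shows "(hd xs, x) \<in> R\<^sup>* \<and> (x, last xs) \<in> R\<^sup>*"
  using assms
proof (induction xs arbitrary: x)
  case (Cons y ys)
  show ?case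
  proof (cases ys)
    case (Cons z zs)
    have s: "(y, z) \<in> R" "successively (\<lambda>p q. (p, q) \<in> R) ys"
      using Cons.prems(1) by (auto simp: Cons)
    have z: "(z, last ys) \<in> R\<^sup>*" using Cons.IH[OF s(2), of z] by (simp add: Cons)
    show ?thesis
    proof (cases "x = y")
      case True
      then show ?thesis using s(1) z by (auto simp: Cons intro: converse_rtrancl_into_rtrancl)
    next
      case False
      then have "x \<in> set ys" using Cons.prems by simp
      then show ?thesis using Cons.IH[OF s(2)] s(1)
        by (auto simp: Cons intro: converse_rtrancl_into_rtrancl)
    qed
  qed (use Cons.prems in simp)
qed simp

lemma rtrancl_distinct_path:
  assumes "(x, y) \<in> R\<^sup>*"
  obtains xs where "xs \<noteq> []" "hd xs = x" "last xs = y" "distinct xs"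
    "successively (\<lambda>p q. (p, q) \<in> R) xs"
proof -
  have "\<exists>xs. xs \<noteq> [] \<and> hd xs = x \<and> last xs = y \<and> distinct xs \<and> successively (\<lambda>p q. (p, q) \<in> R) xs"
    using assms
  proof (induction rule: converse_rtrancl_induct)
    case base
    show ?case by (rule exI[of _ "[y]"]) simp
  next
    case (step x z)
    then obtain xs where xs: "xs \<noteq> []" "hd xs = z" "last xs = y" "distinct xs"
      "successively (\<lambda>p q. (p, q) \<in> R) xs" by blast
    show ?case
    proof (cases "x \<in> set xs")
      case False
      then show ?thesis using xs step.hyps(1)
        by (intro exI[of _ "x # xs"]) (auto simp: successively_Cons)
    next
      case True
      \<comment> \<open>The detour back to \<open>x\<close> is cut off.\<close>
      then obtain us vs where "xs = us @ x # vs" by (meson split_list)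
      then show ?thesis using xs
        by (intro exI[of _ "x # vs"]) (auto simp: successively_append_iff)
    qed
  qed
  then show thesis using that by blast
qed

text \<open>Only first components of consecutive pairs are examined. In a semicycle this spares the
  last vertex, which repeats the first and is an end of the deleted arc.\<close>

lemma successively_change:
  assumes "successively P xs" and "\<And>p q. p \<in> set (butlast xs) \<Longrightarrow> P p q \<Longrightarrow> Q p q"
  shows "successively Q xs"
  using assms by (induction xs rule: induct_list012) auto

lemma semiwalk_iff:
  "semiwalk D xs \<longleftrightarrow> xs \<noteq> [] \<and> set xs \<subseteq> pverts D \<and>
     successively (\<lambda>p q. (p, q) \<in> sym_arcs (parcs D)) xs"
  by (auto simp: semiwalk_def successively_conv_nth sym_arcs_def)

context
  fixes D :: "'a pair_pre_digraph"
  assumes D: "oriented_graph D"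
begin

section \<open>The local conditions as conditions on the set of arcs\<close>

lemma arcs_in_verts: "(p, q) \<in> parcs D \<Longrightarrow> p \<in> pverts D \<and> q \<in> pverts D"
  using D pair_wf_digraph.in_arcsD1 pair_wf_digraph.in_arcsD2
  unfolding oriented_graph_def finite_digraph_def pair_digraph_def pair_fin_digraph_def by metis

lemma finite_arcs: "finite (parcs D)"
  using D pair_fin_digraph.pair_finite_arcs
  unfolding oriented_graph_def finite_digraph_def pair_digraph_def by metis

lemma arcs_asym: "(p, q) \<in> parcs D \<Longrightarrow> (q, p) \<notin> parcs D"
  using D unfolding oriented_graph_def by blast

lemma inner_vertex_iff: "inner_vertex D a \<longleftrightarrow> a \<in> inner_verts (parcs D)"
  using arcs_in_verts unfolding inner_vertex_def W_vertex_def E_vertex_def inner_verts_def by blast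

lemma W_E_functional_iff:
  "W_E_functional D \<longleftrightarrow> out_functional (parcs D) \<and> out_functional ((parcs D)\<inverse>)"
  using arcs_in_verts
  unfolding W_E_functional_def functional_W_edge_def functional_E_edge_def W_edge_def E_edge_def
    W_vertex_def E_vertex_def out_functional_def by (simp add: Range_iff Domain_iff) blast

lemma weakly_connected_iff:
  "weakly_connected D \<longleftrightarrow> (\<forall>a\<in>pverts D. \<forall>b\<in>pverts D. (a, b) \<in> (sym_arcs (parcs D))\<^sup>*)"
proof
  assume c: "weakly_connected D"
  show "\<forall>a\<in>pverts D. \<forall>b\<in>pverts D. (a, b) \<in> (sym_arcs (parcs D))\<^sup>*"
  proof (intro ballI)
    fix a b assume "a \<in> pverts D" "b \<in> pverts D"
    then obtain xs where "semipath D xs" "hd xs = a" "last xs = b"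
      using c unfolding weakly_connected_def by blast
    then show "(a, b) \<in> (sym_arcs (parcs D))\<^sup>*"
      using successively_rtrancl[of "sym_arcs (parcs D)" xs "last xs"]
      unfolding semipath_def semiwalk_iff by auto
  qed
next
  assume c: "\<forall>a\<in>pverts D. \<forall>b\<in>pverts D. (a, b) \<in> (sym_arcs (parcs D))\<^sup>*"
  show "weakly_connected D"
    unfolding weakly_connected_def
  proof (intro ballI)
    fix a b assume ab: "a \<in> pverts D" "b \<in> pverts D"
    then obtain xs where xs: "xs \<noteq> []" "hd xs = a" "last xs = b" "distinct xs"
      "successively (\<lambda>p q. (p, q) \<in> sym_arcs (parcs D)) xs"
      using c rtrancl_distinct_path by metis
    have "x \<in> pverts D" if "x \<in> set xs" for x
    proof -
      have "(a, x) \<in> (sym_arcs (parcs D))\<^sup>*" using successively_rtrancl[OF xs(5) that] xs(2) by simp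
      then show ?thesis
        using ab(1) by (rule rtrancl_sym_arcs_closed) (use arcs_in_verts in blast)
    qed
    then show "\<exists>xs. semipath D xs \<and> hd xs = a \<and> last xs = b"
      using xs unfolding semipath_def semiwalk_iff by blast
  qed
qed

text \<open>A bypass of an arc closes with it to a semicycle; conversely the rest of a semicycle
  bypasses its first edge.\<close>

lemma asemicyclic_iff:
  "asemicyclic D \<longleftrightarrow>
     (\<forall>u v. (u, v) \<in> parcs D \<longrightarrow> (u, v) \<notin> (sym_arcs (parcs D - {(u, v)}))\<^sup>*)"
proof
  assume as: "asemicyclic D"
  show "\<forall>u v. (u, v) \<in> parcs D \<longrightarrow> (u, v) \<notin> (sym_arcs (parcs D - {(u, v)}))\<^sup>*"
  proof (intro allI impI notI)
    fix u v assume uv: "(u, v) \<in> parcs D" and r: "(u, v) \<in> (sym_arcs (parcs D - {(u, v)}))\<^sup>*"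
    obtain xs where xs: "xs \<noteq> []" "hd xs = v" "last xs = u" "distinct xs"
      "successively (\<lambda>p q. (p, q) \<in> sym_arcs (parcs D - {(u, v)})) xs"
      using rtrancl_distinct_path[OF rtrancl_sym_arcs_sym[OF r]] by metis
    have "u \<noteq> v" using arcs_asym uv by blast
    have vu: "(v, u) \<notin> parcs D" using arcs_asym uv by blast
    obtain xs' where xs': "xs = v # xs'" using xs(1,2) by (cases xs) auto
    have "xs' \<noteq> []" using xs(3) \<open>u \<noteq> v\<close> by (auto simp: xs')
    then obtain y ys where ys: "xs = v # y # ys" using xs' by (cases xs') auto
    \<comment> \<open>By antisymmetry the bypass is not a single edge, which gives the length 4
      required of a semicycle.\<close>
    have "ys \<noteq> []"
    proof
      assume "ys = []"
      then have "(v, u) \<in> sym_arcs (parcs D - {(u, v)})" using xs(3,5) by (simp add: ys)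
      then show False using vu by (auto simp: sym_arcs_def)
    qed
    have s: "successively (\<lambda>p q. (p, q) \<in> sym_arcs (parcs D)) xs"
      using xs(5) by (rule successively_mono) (auto simp: sym_arcs_def)
    have "x \<in> pverts D" if "x \<in> set xs" for x
    proof -
      have "(v, x) \<in> (sym_arcs (parcs D))\<^sup>*" using successively_rtrancl[OF s that] xs(2) by simp
      moreover have "v \<in> pverts D" using uv arcs_in_verts by blast
      ultimately show ?thesis by (rule rtrancl_sym_arcs_closed) (use arcs_in_verts in blast)
    qed
    then have "semiwalk D (u # xs)"
      using s uv xs(1,2) arcs_in_verts unfolding semiwalk_iff
      by (auto simp: successively_Cons sym_arcs_def)
    moreover have "distinct (butlast (u # xs))"
    proof -
      have "xs = butlast xs @ [u]" using xs(1,3) append_butlast_last_id by metis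
      then have "distinct (butlast xs @ [u])" using xs(4) by metis
      then show ?thesis using xs(1) by auto
    qed
    moreover have "length (u # xs) \<ge> 4" using \<open>ys \<noteq> []\<close> by (cases ys) (auto simp: ys)
    ultimately have "semicycle D (u # xs)" using xs(1,3) by (simp add: semicycle_def)
    then show False using as unfolding asemicyclic_def by blast
  qed
next
  assume br: "\<forall>u v. (u, v) \<in> parcs D \<longrightarrow> (u, v) \<notin> (sym_arcs (parcs D - {(u, v)}))\<^sup>*"
  show "asemicyclic D"
    unfolding asemicyclic_def
  proof
    assume "\<exists>xs. semicycle D xs"
    then obtain xs where xs: "semicycle D xs" by blast
    then have len: "length xs \<ge> 4" by (simp add: semicycle_def)
    obtain x0 x1 x2 x3 r where r: "xs = x0 # x1 # x2 # x3 # r"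
    proof -
      have "\<exists>x0 x1 x2 x3 r. xs = x0 # x1 # x2 # x3 # r"
        using len by (auto simp: numeral_eq_Suc Suc_le_length_iff)
      then show thesis using that by blast
    qed
    let ?t = "x2 # x3 # r"
    have last: "last ?t = x0" and dist: "distinct (x0 # x1 # butlast ?t)"
      and s: "successively (\<lambda>p q. (p, q) \<in> sym_arcs (parcs D)) ?t"
        "(x0, x1) \<in> sym_arcs (parcs D)" "(x1, x2) \<in> sym_arcs (parcs D)"
      using xs unfolding semicycle_def semiwalk_iff r by auto
    \<comment> \<open>The direction of the first edge is unknown, so both are deleted.\<close>
    define B where "B = parcs D - {(x0, x1), (x1, x0)}"
    have "successively (\<lambda>p q. (p, q) \<in> sym_arcs B) ?t"
      using s(1) by (rule successively_change) (use dist in \<open>auto simp: sym_arcs_def B_def\<close>)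
    then have "(hd ?t, last ?t) \<in> (sym_arcs B)\<^sup>*"
      using successively_rtrancl[of "sym_arcs B" ?t "last ?t"] last_in_set[of ?t] by blast
    then have "(x2, x0) \<in> (sym_arcs B)\<^sup>*" unfolding last by simp
    \<comment> \<open>Here length at least 4 matters: \<open>x2\<close> is not the last vertex and
      so differs from \<open>x0\<close>.\<close>
    moreover have "(x1, x2) \<in> sym_arcs B"
      using s(3) dist by (auto simp: sym_arcs_def B_def)
    ultimately have r10: "(x1, x0) \<in> (sym_arcs B)\<^sup>*" by (rule converse_rtrancl_into_rtrancl[rotated])
    have "(sym_arcs B)\<^sup>* \<subseteq> (sym_arcs (parcs D - {(x0, x1)}))\<^sup>*"
        "(sym_arcs B)\<^sup>* \<subseteq> (sym_arcs (parcs D - {(x1, x0)}))\<^sup>*"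
      by (rule rtrancl_mono; auto simp: sym_arcs_def B_def)+
    then have "(x1, x0) \<in> (sym_arcs (parcs D - {(x1, x0)}))\<^sup>*"
        "(x0, x1) \<in> (sym_arcs (parcs D - {(x0, x1)}))\<^sup>*"
      using r10 rtrancl_sym_arcs_sym[OF r10] by (simp_all only: subsetD)
    then show False using br s(2) by (auto simp: sym_arcs_def)
  qed
qed

text \<open>Decency looks only at the first and the last arc of a path, and acyclicity makes every
  directed walk of inner vertices a path; so the part in between may be replaced by
  reachability.\<close>

lemma decent_iff:
  assumes t: "tree_arcs (parcs D)"
    and e: "\<And>Y a. a \<in> inner_verts (parcs D) \<Longrightarrow> L Y East a = (a, e Y a)"
    and w: "\<And>Y a. a \<in> inner_verts (parcs D) \<Longrightarrow> L Y West a = (w Y a, a)"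
  shows "(\<forall>xs. directed_path D xs \<and> (\<forall>a\<in>set xs. inner_vertex D a) \<longrightarrow> decent D L xs) \<longleftrightarrow>
    (\<forall>Y. decent_pointers (parcs D) (e Y) (w Y))" (is "?L \<longleftrightarrow> ?R")
proof -
  define I where "I = inner_arcs (parcs D)"
  have dp: "directed_path D xs \<and> (\<forall>a\<in>set xs. inner_vertex D a) \<longleftrightarrow>
      xs \<noteq> [] \<and> distinct xs \<and> set xs \<subseteq> inner_verts (parcs D) \<and> successively (\<lambda>p q. (p, q) \<in> I) xs"
    (is "?P xs \<longleftrightarrow> ?Q xs") for xs
  proof
    assume p: "?P xs"
    then have "set xs \<subseteq> inner_verts (parcs D)" "xs \<noteq> []" "distinct xs"
      by (auto simp: inner_vertex_iff directed_path_def semipath_def semiwalk_def)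
    moreover have "successively (\<lambda>p q. (p, q) \<in> I) xs"
      unfolding successively_conv_nth
    proof (intro allI impI)
      fix i assume i: "Suc i < length xs"
      then have "(xs ! i, xs ! Suc i) \<in> parcs D" using p by (simp add: directed_path_def)
      then show "(xs ! i, xs ! Suc i) \<in> I"
        using i \<open>set xs \<subseteq> _\<close> nth_mem[of i xs] nth_mem[of "Suc i" xs] unfolding I_def inner_arcs_def by auto
    qed
    ultimately show "?Q xs" by blast
  next
    assume q: "?Q xs"
    have "(xs ! i, xs ! Suc i) \<in> parcs D" if "Suc i < length xs" for i
      using q that unfolding I_def inner_arcs_def successively_conv_nth by blast
    moreover have "set xs \<subseteq> pverts D"
      using q arcs_in_verts unfolding inner_verts_def by blast
    ultimately show "?P xs"
      using q unfolding directed_path_def semipath_def semiwalk_def inner_vertex_iff by blast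
  qed
  have acyc: "(q, p) \<notin> I\<^sup>*" if "(p, q) \<in> I" for p q
  proof -
    have "I\<^sup>* \<subseteq> (parcs D)\<^sup>*" unfolding I_def by (rule rtrancl_mono[OF inner_arcs_subset])
    then show ?thesis using tree_arcs_acyclic[OF t] that inner_arcs_subset unfolding I_def by blast
  qed
  have inner: "p \<in> inner_verts (parcs D)" "q \<in> inner_verts (parcs D)" if "(p, q) \<in> I" for p q
    using that by (auto simp: I_def inner_arcs_def)
  have dec: "decent D L xs \<longleftrightarrow> length xs = 1 \<or> length xs \<ge> 2 \<and>
      (\<forall>Y. e Y (hd xs) = xs ! 1 \<or> w Y (last xs) = xs ! (length xs - 2))"
    if q: "?Q xs" for xs
  proof -
    have h: "hd xs \<in> inner_verts (parcs D)" "last xs \<in> inner_verts (parcs D)" using q by auto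
    have "hd xs = xs ! 0" "last xs = xs ! (length xs - 1)"
      using q by (simp_all add: hd_conv_nth last_conv_nth)
    then have "Y_decent D L Y xs \<longleftrightarrow> length xs = 1 \<or> length xs \<ge> 2 \<and>
        (e Y (hd xs) = xs ! 1 \<or> w Y (last xs) = xs ! (length xs - 2))" for Y
      unfolding Y_decent_def inner_vertex_iff using h e[OF h(1)] w[OF h(2)] by simp
    moreover have "(\<forall>Y. P Y) \<longleftrightarrow> P North \<and> P South" for P by (metis vertical.exhaust)
    ultimately show ?thesis unfolding decent_def by auto
  qed
  show ?thesis
  proof
    assume ?L
    then have L: "decent D L xs" if "?Q xs" for xs using dp that by blast
    show ?R
      unfolding decent_pointers_def I_def[symmetric]
    proof (intro allI conjI impI)
      fix Y p q assume pq: "(p, q) \<in> I"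
      then have Q: "?Q [p, q]" using inner[OF pq] acyc[OF pq] by auto
      show "e Y p = q \<or> w Y q = p" using L[OF Q] unfolding dec[OF Q] by auto
    next
      fix Y p p' q' q assume pp: "(p, p') \<in> I" and path: "(p', q') \<in> I\<^sup>*" and qq: "(q', q) \<in> I"
      obtain ys where ys: "ys \<noteq> []" "hd ys = p'" "last ys = q'" "distinct ys"
        "successively (\<lambda>p q. (p, q) \<in> I) ys"
        using rtrancl_distinct_path[OF path] by metis
      have y: "(p', y) \<in> I\<^sup>* \<and> (y, q') \<in> I\<^sup>*" if "y \<in> set ys" for y
        using successively_rtrancl[OF ys(5) that] ys by simp
      \<comment> \<open>A repetition would close a directed cycle.\<close>
      have "p \<notin> set ys" "q \<notin> set ys" using y acyc[OF pp] acyc[OF qq] by blast+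
      moreover have "p \<noteq> q" using acyc[OF pp] path qq by (meson rtrancl_into_rtrancl)
      moreover have "set ys \<subseteq> inner_verts (parcs D)"
      proof
        fix z assume "z \<in> set ys"
        then have "(p', z) \<in> I\<^sup>*" using y by blast
        then show "z \<in> inner_verts (parcs D)" by cases (use inner[OF pp] inner in auto)
      qed
      ultimately have Q: "?Q (p # ys @ [q])"
        using ys pp qq inner[OF pp] inner[OF qq]
        by (auto simp: successively_Cons successively_append_iff)
      have "(p # ys @ [q]) ! 1 = p'" "(p # ys @ [q]) ! (length (p # ys @ [q]) - 2) = q'"
        using ys(1-3) by (auto simp: nth_append hd_conv_nth last_conv_nth nth_Cons')
      then show "e Y p = p' \<or> w Y q = q'"
        using L[OF Q] ys(1) unfolding dec[OF Q] by auto
    qed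
  next
    assume R: ?R
    have "decent D L xs" if Q: "?Q xs" for xs
      unfolding dec[OF Q]
    proof (cases "length xs \<ge> 2")
      case False
      moreover have "length xs \<noteq> 0" using Q by simp
      ultimately show "length xs = 1 \<or> length xs \<ge> 2 \<and>
        (\<forall>Y. e Y (hd xs) = xs ! 1 \<or> w Y (last xs) = xs ! (length xs - 2))" by linarith
    next
      case True
      then obtain p xs' where xs': "xs = p # xs'" by (cases xs) auto
      then have "xs' \<noteq> []" using True by auto
      then obtain ys q where xs: "xs = p # ys @ [q]" using xs' by (metis append_butlast_last_id)
      have "e Y p = xs ! 1 \<or> w Y q = xs ! (length xs - 2)" for Y
      proof (cases "ys = []")
        case True
        then show ?thesis using Q R unfolding xs decent_pointers_def I_def[symmetric] by auto
      next
        case False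
        have s: "(p, hd ys) \<in> I" "(last ys, q) \<in> I" "successively (\<lambda>p q. (p, q) \<in> I) ys"
          using Q False unfolding xs by (auto simp: successively_Cons successively_append_iff)
        moreover have "(hd ys, last ys) \<in> I\<^sup>*"
          using successively_rtrancl[OF s(3), of "last ys"] False by simp
        ultimately have "e Y p = hd ys \<or> w Y q = last ys"
          using R unfolding decent_pointers_def I_def[symmetric] by blast
        moreover have "xs ! 1 = hd ys" "xs ! (length xs - 2) = last ys"
          using False by (auto simp: xs nth_append hd_conv_nth last_conv_nth nth_Cons')
        ultimately show ?thesis by simp
      qed
      then show "length xs = 1 \<or> length xs \<ge> 2 \<and>
        (\<forall>Y. e Y (hd xs) = xs ! 1 \<or> w Y (last xs) = xs ! (length xs - 2))"
        using True by (simp add: xs)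
    qed
    then show ?L using dp by blast
  qed
qed

lemma separates_iff:
  assumes e: "\<And>Y a. a \<in> inner_verts (parcs D) \<Longrightarrow> L Y East a = (a, e Y a)"
    and w: "\<And>Y a. a \<in> inner_verts (parcs D) \<Longrightarrow> L Y West a = (w Y a, a)"
  shows "separates_N_from_S D L \<longleftrightarrow> separating (parcs D) e \<and> separating ((parcs D)\<inverse>) w"
proof -
  have two: "card S \<ge> 2 \<longleftrightarrow> (\<exists>x\<in>S. \<exists>y\<in>S. x \<noteq> y)" if "finite S" for S :: "('a \<times> 'a) set"
  proof -
    have "card S \<ge> 2 \<longleftrightarrow> \<not> card S \<le> Suc 0" by linarith
    then show ?thesis using card_le_Suc0_iff_eq[OF that] by blast
  qed
  have inn: "in_degree (with_proj D) a \<ge> 2 \<longleftrightarrow> (\<exists>p q. (p, a) \<in> parcs D \<and> (q, a) \<in> parcs D \<and> p \<noteq> q)" for a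
    unfolding in_degree_def in_arcs_def
    by (subst two) (auto simp: finite_arcs)
  have out: "out_degree (with_proj D) a \<ge> 2 \<longleftrightarrow> (\<exists>p q. (a, p) \<in> parcs D \<and> (a, q) \<in> parcs D \<and> p \<noteq> q)" for a
    unfolding out_degree_def out_arcs_def
    by (subst two) (auto simp: finite_arcs)
  show ?thesis
    unfolding separates_N_from_S_def separating_def inn out inner_vertex_iff inner_verts_converse
    by (auto simp: e w)
qed

lemma local_compass_graph_iff:
  assumes e: "\<And>Y a. a \<in> inner_verts (parcs D) \<Longrightarrow> L Y East a = (a, e Y a)"
    and w: "\<And>Y a. a \<in> inner_verts (parcs D) \<Longrightarrow> L Y West a = (w Y a, a)"
  shows "local_compass_graph D L \<longleftrightarrow> pverts D = Field (parcs D) \<and> kgraph (parcs D) e w"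
proof -
  have compass: "compass_on D L \<longleftrightarrow> pointers (parcs D) e \<and> pointers ((parcs D)\<inverse>) w"
    unfolding compass_on_def inner_vertex_iff pointers_def inner_verts_converse
    by (auto simp: e w)
  have F: "Field (parcs D) \<subseteq> pverts D" using arcs_in_verts by (auto simp: Field_def)
  \<comment> \<open>The inner vertex is kept on both sides because a single vertex without arcs is
    weakly connected as well; with an inner vertex present, connectedness forbids isolated
    vertices.\<close>
  have tree: "weakly_connected D \<and> asemicyclic D \<and> inner_verts (parcs D) \<noteq> {} \<longleftrightarrow>
      pverts D = Field (parcs D) \<and> tree_arcs (parcs D) \<and> inner_verts (parcs D) \<noteq> {}"
  proof (cases "pverts D = Field (parcs D)")
    case True
    then show ?thesis unfolding weakly_connected_iff asemicyclic_iff tree_arcs_def by blast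
  next
    case False
    then obtain x where x: "x \<in> pverts D" "x \<notin> Field (parcs D)" using F by blast
    have "\<not> weakly_connected D" if "y \<in> inner_verts (parcs D)" for y
    proof
      assume "weakly_connected D"
      have y: "y \<in> Field (parcs D)" using that by (auto simp: inner_verts_def Field_def)
      then have "(y, x) \<in> (sym_arcs (parcs D))\<^sup>*"
        using \<open>weakly_connected D\<close> x F unfolding weakly_connected_iff by blast
      then have "x \<in> Field (parcs D)"
        using y by (rule rtrancl_sym_arcs_closed) (auto simp: Field_def)
      then show False using x by blast
    qed
    then show ?thesis using False by blast
  qed
  have inner: "(\<exists>a. inner_vertex D a) \<longleftrightarrow> inner_verts (parcs D) \<noteq> {}"
    by (auto simp: inner_vertex_iff)
  have sep: "separates_N_from_S D L \<longleftrightarrow> separating (parcs D) e \<and> separating ((parcs D)\<inverse>) w"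
    by (rule separates_iff) (simp_all add: e w)
  have dec: "(\<forall>xs. directed_path D xs \<and> (\<forall>a\<in>set xs. inner_vertex D a) \<longrightarrow> decent D L xs) \<longleftrightarrow>
      (\<forall>Y. decent_pointers (parcs D) (e Y) (w Y))" if "tree_arcs (parcs D)"
    by (rule decent_iff[OF that]) (simp_all add: e w)
  have "local_compass_graph D L \<longleftrightarrow>
      (weakly_connected D \<and> asemicyclic D \<and> inner_verts (parcs D) \<noteq> {}) \<and>
      pointers (parcs D) e \<and> pointers ((parcs D)\<inverse>) w \<and>
      out_functional (parcs D) \<and> out_functional ((parcs D)\<inverse>) \<and>
      separating (parcs D) e \<and> separating ((parcs D)\<inverse>) w \<and>
      (\<forall>xs. directed_path D xs \<and> (\<forall>a\<in>set xs. inner_vertex D a) \<longrightarrow> decent D L xs)"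
    unfolding local_compass_graph_def compass W_E_functional_iff inner sep
    using D by blast
  also have "\<dots> \<longleftrightarrow> pverts D = Field (parcs D) \<and> kgraph (parcs D) e w"
    unfolding tree kgraph_def using dec finite_arcs by blast
  finally show ?thesis .
qed

lemma local_K_graph_iff:
  "local_K_graph D \<longleftrightarrow> pverts D = Field (parcs D) \<and> (\<exists>e w. kgraph (parcs D) e w)"
proof
  assume "local_K_graph D"
  then obtain L where L: "local_compass_graph D L" unfolding local_K_graph_def by blast
  then have c: "compass_on D L" by (simp add: local_compass_graph_def)
  have "L Y East a = (a, snd (L Y East a))" "L Y West a = (fst (L Y West a), a)"
    if "a \<in> inner_verts (parcs D)" for Y a
    using c that unfolding compass_on_def inner_vertex_iff by (metis prod.collapse)+
  then show "pverts D = Field (parcs D) \<and> (\<exists>e w. kgraph (parcs D) e w)"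
    using L local_compass_graph_iff[of L "\<lambda>Y a. snd (L Y East a)" "\<lambda>Y a. fst (L Y West a)"] by blast
next
  assume "pverts D = Field (parcs D) \<and> (\<exists>e w. kgraph (parcs D) e w)"
  then obtain e w where k: "pverts D = Field (parcs D)" "kgraph (parcs D) e w" by blast
  define L where "L Y X a = (case X of West \<Rightarrow> (w Y a, a) | East \<Rightarrow> (a, e Y a))" for Y :: vertical and X and a :: 'a
  have "local_compass_graph D L"
    using local_compass_graph_iff[of L e w] k by (simp add: L_def)
  then show "local_K_graph D" using D unfolding local_K_graph_def by blast
qed

end

theorem mainTheorem3:
  fixes D :: "'a pair_pre_digraph"
  assumes "infinite (UNIV :: 'a set)" and "oriented_graph D"
  shows "global_K_graph D \<longleftrightarrow> local_K_graph D"
proof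
  assume "global_K_graph D"
  then obtain G where "construction G" "root_graph G = D" unfolding global_K_graph_def by blast
  then obtain A e w where "D = \<lparr>pverts = Field A, parcs = A\<rparr>" "kgraph A e w"
    using construction_kgraph by metis
  then show "local_K_graph D" using local_K_graph_iff[OF assms(2)] by auto
next
  assume "local_K_graph D"
  then obtain e w where "pverts D = Field (parcs D)" "kgraph (parcs D) e w"
    using local_K_graph_iff[OF assms(2)] by blast
  moreover from this obtain G where "construction G"
    "root_graph G = \<lparr>pverts = Field (parcs D), parcs = parcs D\<rparr>"
    using kgraph_construction[OF assms(1)] by blast
  ultimately show "global_K_graph D"
    unfolding global_K_graph_def using assms(2) by (intro conjI exI[of _ G]) simp_all
qed

end
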